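(* There is an algorithm with the following specification. The input is a positive integer $n$ and the first row $(a_0,a_1,\dots,a_{n-1})\in\mathbb{R}^n$ of a symmetric Toeplitz matrix $A=T[a_0,a_1,\dots,a_{n-1}]$ of order $n$. The output consists of (i) the number $c$ of connected components of the weighted Toeplitz graph $G(A)$ together with a component index sequence of $A$, i.e. a map $\rho:[n]\to[c]$ such that for all $u,v\in[n]$, $\rho(u)=\rho(v)$ if and only if $u$ and $v$ lie in the same connected component of $G(A)$; and (ii) for each $i\in[c]$, the first row of a symmetric irreducible Toeplitz matrix $T_i$, such that the block diagonal matrix $\operatorname{diag}(T_1,\dots,T_c)$ is the Frobenius normal form of $A$, i.e. $P^{T}AP=\operatorname{diag}(T_1,\dots,T_c)$ for some permutation matrix $P$. The running time of the algorithm is $\mathcal{O}(n)$, with an absolute implied constant.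
   Context: $[n]=\{1,\dots,n\}$. For real numbers $a_0,\dots,a_{n-1}$, $T[a_0,a_1,\dots,a_{n-1}]$ denotes the symmetric Toeplitz matrix of order $n$ whose $(i,j)$ entry is $a_{|i-j|}$ for $i,j\in[n]$. Put $S_A=\{i\in\{0,\dots,n-1\}: a_i\neq 0\}$. The weighted Toeplitz graph $G(A)$ has vertex set $[n]$, edges $ij$ (loops allowed) whenever $|i-j|\in S_A$, and weight $a_{|i-j|}$ on the edge $ij$ (so $A$ is its adjacency matrix). A square matrix is reducible if by a simultaneous permutation of its rows and columns it can be brought to the form $\begin{bmatrix}A_1&A_{12}\\O&A_2\end{bmatrix}$ with $A_1,A_2$ square of order at least one; otherwise it is irreducible (so every $1\times1$ matrix is irreducible). For a symmetric matrix $A$, the Frobenius normal form is a block diagonal matrix with symmetric irreducible diagonal blocks obtained from $A$ by a simultaneous permutation of rows and columns; the diagonal blocks are unique up to order and simultaneous permutation of their lines. Running time is counted in the usual unit-cost (random access machine) model: arithmetic operations (including integer division with remainder), comparisons, and memory accesses on integers of size $\mathcal{O}(n)$, as well as copying an entry $a_i$ or testing whether $a_i=0$, each take $\mathcal{O}(1)$ time. *)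

theory Defs
  imports
    "Jordan_Normal_Form.Matrix"
    "HOL-Combinatorics.Permutations"
begin

section \<open>Toeplitz matrices and Toeplitz graphs\<close>

text \<open>A first row \<open>(a\<^sub>0, \<dots>, a\<^sub>n\<^sub>-\<^sub>1)\<close> is a list of length \<open>n\<close>. Matrix indices start at \<open>0\<close>,
  graph vertices at \<open>1\<close>; both conventions give the same differences \<open>\<bar>i - j\<bar>\<close>.\<close>

definition toeplitz_mat :: "real list \<Rightarrow> real mat" where
  "toeplitz_mat a = mat (length a) (length a) (\<lambda>(i, j). a ! nat \<bar>int i - int j\<bar>)"

definition toeplitz_support :: "real list \<Rightarrow> nat set" where
  "toeplitz_support a = {i. i < length a \<and> a ! i \<noteq> 0}"

text \<open>An undirected edge is represented by both of its orientations, a loop at \<open>i\<close> by \<open>(i, i)\<close>.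
  The weight is meaningful on edges only.\<close>

record wgraph =
  verts :: "nat set"
  edges :: "(nat \<times> nat) set"
  weight :: "nat \<Rightarrow> nat \<Rightarrow> real"

definition toeplitz_graph :: "real list \<Rightarrow> wgraph" where
  "toeplitz_graph a =
    \<lparr> verts = {1..length a},
      edges = {(i, j). i \<in> {1..length a} \<and> j \<in> {1..length a} \<and>
                       nat \<bar>int i - int j\<bar> \<in> toeplitz_support a},
      weight = (\<lambda>i j. a ! nat \<bar>int i - int j\<bar>) \<rparr>"

definition connected_rel :: "wgraph \<Rightarrow> (nat \<times> nat) set" where
  "connected_rel G = (edges G)\<^sup>* \<inter> verts G \<times> verts G"

definition components :: "wgraph \<Rightarrow> nat set set" where
  "components G = verts G // connected_rel G"

definition component_index_sequence :: "wgraph \<Rightarrow> nat \<Rightarrow> (nat \<Rightarrow> nat) \<Rightarrow> bool" where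
  "component_index_sequence G c \<rho> \<longleftrightarrow>
    (\<forall>u \<in> verts G. \<rho> u \<in> {1..c}) \<and>
    (\<forall>u \<in> verts G. \<forall>v \<in> verts G. \<rho> u = \<rho> v \<longleftrightarrow> (\<exists>K \<in> components G. u \<in> K \<and> v \<in> K))"


section \<open>Irreducibility and the Frobenius normal form\<close>

definition permutation_mat :: "nat \<Rightarrow> real mat \<Rightarrow> bool" where
  "permutation_mat n P \<longleftrightarrow>
    (\<exists>\<pi>. \<pi> permutes {..<n} \<and> P = mat n n (\<lambda>(i, j). if i = \<pi> j then 1 else 0))"

definition reducible_mat :: "real mat \<Rightarrow> bool" where
  "reducible_mat A \<longleftrightarrow>
    (\<exists>P k m A1 A12 A2. 1 \<le> k \<and> 1 \<le> m \<and>
       A1 \<in> carrier_mat k k \<and> A12 \<in> carrier_mat k m \<and> A2 \<in> carrier_mat m m \<and>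
       permutation_mat (dim_row A) P \<and>
       transpose_mat P * A * P = four_block_mat A1 A12 (0\<^sub>m m k) A2)"

definition irreducible_mat :: "real mat \<Rightarrow> bool" where
  "irreducible_mat A \<longleftrightarrow> square_mat A \<and> 1 \<le> dim_row A \<and> \<not> reducible_mat A"

definition frobenius_normal_form :: "real mat \<Rightarrow> real mat list \<Rightarrow> bool" where
  "frobenius_normal_form A Bs \<longleftrightarrow>
    (\<forall>B \<in> set Bs. irreducible_mat B \<and> transpose_mat B = B) \<and>
    (\<exists>P. permutation_mat (dim_row A) P \<and> transpose_mat P * A * P = diag_block_mat Bs)"


section \<open>The unit-cost random access machine\<close>

text \<open>The machine has integer registers, an integer memory and a memory of real entries; memories
  are addressed indirectly through registers. A real entry can only be copied to another cell or
  tested for being zero. Integers are natural numbers: subtraction is truncated at \<open>0\<close>, and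
  \<open>Div\<close>, \<open>Mod\<close> follow the HOL conventions \<open>x div 0 = 0\<close>, \<open>x mod 0 = x\<close>. In instructions, register
  numbers come first (the destination, if any, in front) and jump targets last.\<close>

datatype instr =
    Const nat nat
  | Move nat nat
  | Add nat nat nat
  | Sub nat nat nat
  | Mul nat nat nat
  | Div nat nat nat
  | Mod nat nat nat
  | Load nat nat
  | Store nat nat
  | Copy_Entry nat nat
  | Jump nat
  | Jump_Eq nat nat nat
  | Jump_Less nat nat nat
  | Jump_Entry_Zero nat nat

type_synonym program = "instr list"

record config =
  pc :: nat
  reg :: "nat \<Rightarrow> nat"
  mem :: "nat \<Rightarrow> nat"
  entry :: "nat \<Rightarrow> real"

definition set_reg :: "nat \<Rightarrow> nat \<Rightarrow> config \<Rightarrow> config" where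
  "set_reg r x s = s\<lparr>pc := pc s + 1, reg := (reg s)(r := x)\<rparr>"

definition branch :: "bool \<Rightarrow> nat \<Rightarrow> config \<Rightarrow> config" where
  "branch b l s = s\<lparr>pc := (if b then l else pc s + 1)\<rparr>"

fun exec :: "instr \<Rightarrow> config \<Rightarrow> config" where
  "exec (Const r k) s = set_reg r k s"
| "exec (Move r p) s = set_reg r (reg s p) s"
| "exec (Add r p q) s = set_reg r (reg s p + reg s q) s"
| "exec (Sub r p q) s = set_reg r (reg s p - reg s q) s"
| "exec (Mul r p q) s = set_reg r (reg s p * reg s q) s"
| "exec (Div r p q) s = set_reg r (reg s p div reg s q) s"
| "exec (Mod r p q) s = set_reg r (reg s p mod reg s q) s"
| "exec (Load r p) s = set_reg r (mem s (reg s p)) s"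
| "exec (Store p q) s = s\<lparr>pc := pc s + 1, mem := (mem s)(reg s p := reg s q)\<rparr>"
| "exec (Copy_Entry p q) s =
     s\<lparr>pc := pc s + 1, entry := (entry s)(reg s p := entry s (reg s q))\<rparr>"
| "exec (Jump l) s = branch True l s"
| "exec (Jump_Eq p q l) s = branch (reg s p = reg s q) l s"
| "exec (Jump_Less p q l) s = branch (reg s p < reg s q) l s"
| "exec (Jump_Entry_Zero p l) s = branch (entry s (reg s p) = 0) l s"

definition halted :: "program \<Rightarrow> config \<Rightarrow> bool" where
  "halted P s \<longleftrightarrow> length P \<le> pc s"

definition step :: "program \<Rightarrow> config \<Rightarrow> config" where
  "step P s = (if halted P s then s else exec (P ! pc s) s)"

definition words_at_most :: "nat \<Rightarrow> config \<Rightarrow> bool" where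
  "words_at_most B s \<longleftrightarrow> (\<forall>r. reg s r \<le> B) \<and> (\<forall>i. mem s i \<le> B)"

text \<open>Unit cost is justified only as long as all integers stay small; hence the bound \<open>B\<close> on every
  integer occurring in the run, including the addresses used.\<close>

definition computes_within :: "program \<Rightarrow> nat \<Rightarrow> nat \<Rightarrow> config \<Rightarrow> config \<Rightarrow> bool" where
  "computes_within P t B s s' \<longleftrightarrow>
    (\<exists>k \<le> t. (step P ^^ k) s = s' \<and> halted P s' \<and>
             (\<forall>j \<le> k. words_at_most B ((step P ^^ j) s)))"


section \<open>Input and output conventions\<close>

text \<open>Input: \<open>n\<close> in register \<open>0\<close> and \<open>a\<^sub>i\<close> in entry cell \<open>i\<close>; everything else is zero.\<close>

definition initial_config :: "nat \<Rightarrow> real list \<Rightarrow> config" where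
  "initial_config n a =
    \<lparr> pc = 0,
      reg = (\<lambda>r. if r = 0 then n else 0),
      mem = (\<lambda>i. 0),
      entry = (\<lambda>i. if i < length a then a ! i else 0) \<rparr>"

text \<open>Output: \<open>c\<close> in register \<open>0\<close>; \<open>\<rho>(u)\<close> in memory cell \<open>u\<close> for \<open>1 \<le> u \<le> n\<close>; the order of \<open>T\<^sub>i\<close> in
  memory cell \<open>n + i\<close> for \<open>1 \<le> i \<le> c\<close>; the first rows of \<open>T\<^sub>1, \<dots>, T\<^sub>c\<close> one after the other in the
  entry cells from \<open>n\<close> on.\<close>

definition output_count :: "config \<Rightarrow> nat" where
  "output_count s = reg s 0"

definition output_index :: "config \<Rightarrow> nat \<Rightarrow> nat" where
  "output_index s u = mem s u"

definition output_row :: "nat \<Rightarrow> config \<Rightarrow> nat \<Rightarrow> real list" where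
  "output_row n s i =
    (let start = n + (\<Sum>j = 1..<i. mem s (n + j))
     in map (entry s) [start..<start + mem s (n + i)])"

definition output_rows :: "nat \<Rightarrow> config \<Rightarrow> real list list" where
  "output_rows n s = map (output_row n s) [1..<output_count s + 1]"

end

theory Submission
  imports Defs
begin

text \<open>
  Call a position \<open>x\<close> marked if \<open>a\<^sub>x \<noteq> 0\<close>. On \<open>{1..n}\<close> with the marked positions as differences, let
  \<open>p\<close> be the least one. A step by \<open>q > p\<close> from \<open>i\<close> to \<open>i + q\<close> can be replaced by a step by \<open>q - p\<close> inside
  \<open>{1..n - p}\<close> followed by a step by \<open>p\<close>. So connectivity does not change when every vertex
  \<open>v > n - p\<close> keeps only its edge to \<open>v - p\<close> (if \<open>v > p\<close>), and the rest lives on \<open>{1..n - p}\<close> with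
  the differences \<open>q - p\<close> and \<open>p\<close>. This is one step of the subtractive Euclidean algorithm
  (lemma \<open>difference_edges_step\<close>).

  The vertex bound and all differences decrease by the same \<open>p\<close>. Hence the differences need not be
  rewritten: storing the total \<open>b\<close> subtracted so far, position \<open>x\<close> stands for the difference \<open>x - b\<close>,
  and the step amounts to \<open>b := x\<close> and marking \<open>x + p\<close>. Looking for the next least difference
  continues where the previous search stopped, so the whole reduction is one scan of the
  positions \<open>1, \<dots>, n - 1\<close>, and it ends with a forest in which \<open>v\<close> has the parent \<open>v - p\<close>, \<open>p\<close> being
  the step that removed \<open>v\<close> (\<open>scan_parent_edges\<close>). Since parents are smaller than their children,
  one further pass over \<open>1, \<dots>, n\<close> gives every root a new label and every other vertex the label of
  its parent; equal labels mean equal components (\<open>label_eq_iff\<close>).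

  For the second part, list each component \<open>K\<close> increasingly as \<open>v\<^sub>0 < v\<^sub>1 < \<dots>\<close>. If \<open>q\<close> is a
  difference with \<open>a\<^sub>q \<noteq> 0\<close>, then \<open>K\<close> is closed under adding and subtracting \<open>q\<close> within \<open>{1..n}\<close>.
  So if two elements of \<open>K\<close> have distance \<open>q\<close>, their successors in \<open>K\<close> have distance \<open>q\<close> too
  (\<open>closed_entries_shift\<close>): the submatrix on \<open>K\<close> is the Toeplitz matrix with first row
  \<open>a\<^bsub>v\<^sub>j - v\<^sub>0\<^esub>\<close>. It is irreducible as \<open>K\<close> is connected (\<open>irreducible_mat_on\<close>). Writing these rows
  one after the other is a counting sort of the vertices by label. The machine program makes four
  simple loops; each is verified by an invariant that ties the machine state to
  the functions \<open>scan\<close>, \<open>offset\<close>, \<open>label\<close> and \<open>label_class\<close>.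
\<close>

section \<open>Replacing edges without changing connectivity\<close>

definition equiv_closure :: "'a rel \<Rightarrow> 'a rel" where
  "equiv_closure R = (R \<union> R\<inverse>)\<^sup>*"

lemma equiv_closure_refl [simp]: "(x, x) \<in> equiv_closure R"
  by (simp add: equiv_closure_def)

lemma equiv_closure_base: "(x, y) \<in> R \<Longrightarrow> (x, y) \<in> equiv_closure R"
  by (auto simp: equiv_closure_def)

lemma equiv_closure_sym: "(x, y) \<in> equiv_closure R \<Longrightarrow> (y, x) \<in> equiv_closure R"
  unfolding equiv_closure_def by (metis sym_Un_converse sym_rtrancl symD)

lemma equiv_closure_trans [trans]: "(x, y) \<in> equiv_closure R \<Longrightarrow> (y, z) \<in> equiv_closure R \<Longrightarrow> (x, z) \<in> equiv_closure R"
  by (auto simp: equiv_closure_def)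

lemma equiv_closure_mono: "R \<subseteq> Q \<Longrightarrow> equiv_closure R \<subseteq> equiv_closure Q"
  unfolding equiv_closure_def by (intro rtrancl_mono) auto

lemma equiv_closure_least: "R \<subseteq> equiv_closure Q \<Longrightarrow> equiv_closure R \<subseteq> equiv_closure Q"
proof -
  assume R: "R \<subseteq> equiv_closure Q"
  hence "R \<union> R\<inverse> \<subseteq> (Q \<union> Q\<inverse>)\<^sup>*"
    using equiv_closure_sym[of _ _ Q] by (auto simp: equiv_closure_def)
  thus ?thesis unfolding equiv_closure_def by (rule rtrancl_subset_rtrancl)
qed

lemma equiv_closure_exchange:
  assumes "R \<subseteq> equiv_closure Q" and "Q \<subseteq> equiv_closure R"
  shows "equiv_closure (R \<union> F) = equiv_closure (Q \<union> F)"
proof (intro equalityI equiv_closure_least)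
  show "R \<union> F \<subseteq> equiv_closure (Q \<union> F)"
    using assms(1) equiv_closure_mono[of Q "Q \<union> F"] by (auto intro: equiv_closure_base)
  show "Q \<union> F \<subseteq> equiv_closure (R \<union> F)"
    using assms(2) equiv_closure_mono[of R "R \<union> F"] by (auto intro: equiv_closure_base)
qed

text \<open>The graph on \<open>{1..n - b}\<close> in which position \<open>x \<in> M\<close> stands for the difference \<open>x - b\<close>. Positions
  up to \<open>b\<close> are inert as \<open>j - i > 0\<close>, and so are those from \<open>n\<close> on; hence \<open>M\<close> is never cleaned up.\<close>

definition difference_edges :: "nat \<Rightarrow> nat \<Rightarrow> nat set \<Rightarrow> nat rel" where
  "difference_edges n b M = {(i, j). 1 \<le> i \<and> i < j \<and> j \<le> n - b \<and> b + (j - i) \<in> M}"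

definition parent_edges :: "nat \<Rightarrow> (nat \<Rightarrow> nat) \<Rightarrow> nat rel" where
  "parent_edges n d = {(v - d v, v) | v. d v < v \<and> v \<le> n}"

text \<open>The Euclidean step. An edge of difference \<open>q > p\<close> ending in \<open>j\<close> is the edge of difference \<open>q - p\<close> ending in
  \<open>j - p\<close> followed by the edge from \<open>j - p\<close> to \<open>j\<close>; the latter is among the new edges of
  difference \<open>p\<close> if \<open>j \<le> n - x\<close> and among the parent edges \<open>N\<close> otherwise. That \<open>x\<close> is the first
  marked position beyond \<open>b\<close> excludes \<open>q < p\<close>. The set \<open>F\<close> stands for the parent edges of earlier steps.\<close>

lemma difference_edges_step:
  assumes bx: "b < x" "x < n" "x \<in> M" and gap: "\<And>y. b < y \<Longrightarrow> y < x \<Longrightarrow> y \<notin> M"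
  defines "p \<equiv> x - b"
  defines "N \<equiv> {(v - p, v) | v. p < v \<and> n - x < v \<and> v \<le> n - b}"
  shows "equiv_closure (difference_edges n b M \<union> F) = equiv_closure (difference_edges n x (insert (x + p) M) \<union> N \<union> F)"
proof (rule equiv_closure_exchange)
  let ?E = "difference_edges n b M" and ?E' = "difference_edges n x (insert (x + p) M)"
  have p: "0 < p" "b + p = x" "n - x + p = n - b" using bx by (auto simp: p_def)
  show "?E \<subseteq> equiv_closure (?E' \<union> N)"
  proof (rule subrelI)
    fix i j assume "(i, j) \<in> ?E"
    hence ij: "1 \<le> i" "i < j" "j \<le> n - b" "b + (j - i) \<in> M" by (auto simp: difference_edges_def)
    have "x \<le> b + (j - i)" using gap[of "b + (j - i)"] ij by force
    hence q: "p \<le> j - i" using p by linarith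
    have i: "i \<le> j - p" "j - p \<le> n - x" "p < j" using q ij p by linarith+
    have "(i, j - p) \<in> equiv_closure (?E' \<union> N)"
    proof (cases "i = j - p")
      case False
      hence "x + (j - p - i) = b + (j - i)" using q p i by linarith
      hence "(i, j - p) \<in> ?E'" using ij i False by (auto simp: difference_edges_def)
      thus ?thesis by (auto intro: equiv_closure_base)
    qed simp
    also have "(j - p, j) \<in> equiv_closure (?E' \<union> N)"
    proof (cases "n - x < j")
      case True
      hence "(j - p, j) \<in> N" using i ij by (auto simp: N_def)
      thus ?thesis by (auto intro: equiv_closure_base)
    next
      case False
      hence "(j - p, j) \<in> ?E'" using i p by (auto simp: difference_edges_def)
      thus ?thesis by (auto intro: equiv_closure_base)
    qed
    finally show "(i, j) \<in> equiv_closure (?E' \<union> N)" .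
  qed
  have down: "(i, i + p) \<in> equiv_closure ?E" if "1 \<le> i" "i + p \<le> n - b" for i
    using that p bx by (auto intro!: equiv_closure_base simp: difference_edges_def)
  show "?E' \<union> N \<subseteq> equiv_closure ?E"
  proof (rule subrelI)
    fix i j assume "(i, j) \<in> ?E' \<union> N"
    thus "(i, j) \<in> equiv_closure ?E"
    proof
      assume "(i, j) \<in> N"
      thus ?thesis using down[of i] by (auto simp: N_def)
    next
      assume "(i, j) \<in> ?E'"
      hence ij: "1 \<le> i" "i < j" "j \<le> n - x" "x + (j - i) \<in> insert (x + p) M"
        by (auto simp: difference_edges_def)
      show ?thesis
      proof (cases "j - i = p")
        case True
        hence "j = i + p" using ij by linarith
        thus ?thesis using down[of i] ij p by simp
      next
        case False
        hence "b + (j + p - i) \<in> M" using ij p by (auto simp: algebra_simps)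
        hence "(i, j + p) \<in> ?E" using ij p by (auto simp: difference_edges_def)
        hence "(i, j + p) \<in> equiv_closure ?E" by (rule equiv_closure_base)
        also have "(j + p, j) \<in> equiv_closure ?E" by (rule equiv_closure_sym, rule down) (use ij p in auto)
        finally show ?thesis .
      qed
    qed
  qed
qed

section \<open>The scan\<close>

text \<open>The components of the state are the amount subtracted so far, the marks added to \<open>S\<close>, and for each
  position where a step was made its length; \<open>0\<close> means that there was none.\<close>

primrec scan :: "nat set \<Rightarrow> nat \<Rightarrow> nat \<times> nat set \<times> (nat \<Rightarrow> nat)" where
  "scan S 0 = (0, {}, (\<lambda>_. 0))"
| "scan S (Suc k) =
    (let (b, m, g) = scan S k; x = Suc k; p = x - b
     in if x \<in> S \<union> m then (x, insert (x + p) m, g(x := p)) else (b, m, g))"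

text \<open>The length of the step that removed vertex \<open>v\<close>: a step from \<open>b\<close> to \<open>x\<close> removes the vertices in
  \<open>(n - x, n - b]\<close>, so the relevant step is the first one at a position \<open>x > n - v\<close>. Going
  through the vertices upwards visits these positions downwards, and it suffices to remember the last
  nonzero value of \<open>g\<close>. The initial value \<open>n\<close> is the default for vertices that no step removed: being
  at least \<open>v\<close>, it makes them roots.\<close>

primrec offset :: "nat \<Rightarrow> (nat \<Rightarrow> nat) \<Rightarrow> nat \<Rightarrow> nat" where
  "offset n g 0 = n"
| "offset n g (Suc v) = (if g (n - v) \<noteq> 0 then g (n - v) else offset n g v)"

lemma offset_pos: "0 < n \<Longrightarrow> 0 < offset n g v"
  by (induction v) auto

lemma offset_initial:
  assumes "\<And>y. b < y \<Longrightarrow> g y = 0" and "v \<le> n - b"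
  shows "offset n g v = n"
  using assms(2) by (induction v) (auto simp: assms(1))

text \<open>Recording a new step at \<open>x\<close> changes the offsets of the vertices it removes and of no others,
  because the step recorded at \<open>b\<close> shields those removed before.\<close>

lemma offset_update:
  assumes b: "b < x" "x < n" "b = 0 \<or> g b \<noteq> 0" and g: "\<And>y. b < y \<Longrightarrow> g y = 0" and v: "v \<le> n"
    and p: "p \<noteq> 0"
  shows "offset n (g(x := p)) v = (if n - x < v \<and> v \<le> n - b then p else offset n g v)"
  using v
proof (induction v)
  case 0
  thus ?case using b by auto
next
  case (Suc v)
  let ?y = "n - v"
  consider "x < ?y" | "?y = x" | "b < ?y" "?y < x" | "?y = b" | "?y < b" by linarith
  thus ?case
  proof cases
    case 1
    thus ?thesis using Suc b by auto
  next
    case 2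
    thus ?thesis using Suc b p by auto
  next
    case 3
    thus ?thesis using Suc b p g[of ?y] by auto
  next
    case 4
    thus ?thesis using Suc b by auto
  next
    case 5
    thus ?thesis using Suc b by auto
  qed
qed

text \<open>The vertices beyond \<open>n - b\<close> hang on parent edges, the others still carry the difference
  graph; no marked position lies between the base \<open>b\<close> and the current position.\<close>

lemma scan_invariant:
  assumes "k < n" "scan S k = (b, m, g)"
  shows "b \<le> k \<and> (b = 0 \<or> g b \<noteq> 0) \<and> (\<forall>y > b. g y = 0) \<and>
    (\<forall>y \<in> S \<union> m. b < y \<longrightarrow> k < y) \<and>
    equiv_closure (difference_edges n 0 S) = equiv_closure (difference_edges n b (S \<union> m) \<union> parent_edges n (offset n g))"
  using assms
proof (induction k arbitrary: b m g)
  case 0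
  have "offset n (\<lambda>_. 0) v = n" for v by (induction v) auto
  hence "parent_edges n (offset n (\<lambda>_. 0)) = {}" by (auto simp: parent_edges_def)
  thus ?case using 0 by auto
next
  case (Suc k)
  obtain b0 m0 g0 where s: "scan S k = (b0, m0, g0)" by (metis prod_cases3)
  let ?x = "Suc k" and ?p = "Suc k - b0"
  from Suc.IH[OF _ s] Suc.prems(1) have IH: "b0 \<le> k" "b0 = 0 \<or> g0 b0 \<noteq> 0" "\<And>y. b0 < y \<Longrightarrow> g0 y = 0"
    "\<And>y. y \<in> S \<union> m0 \<Longrightarrow> b0 < y \<Longrightarrow> k < y"
    "equiv_closure (difference_edges n 0 S) = equiv_closure (difference_edges n b0 (S \<union> m0) \<union> parent_edges n (offset n g0))"
    by auto
  show ?case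
  proof (cases "?x \<in> S \<union> m0")
    case False
    hence eq: "b = b0" "m = m0" "g = g0" using Suc.prems s by (auto simp: Let_def)
    have "Suc k < y" if "y \<in> S \<union> m0" "b0 < y" for y
      using IH(4)[OF that] that False by (cases "y = Suc k") auto
    thus ?thesis using IH eq by auto
  next
    case True
    hence eq: "b = ?x" "m = insert (?x + ?p) m0" "g = g0(?x := ?p)"
      using Suc.prems s by (auto simp: Let_def)
    let ?N = "{(v - ?p, v) | v. ?p < v \<and> n - ?x < v \<and> v \<le> n - b0}"
    have upd: "offset n g v = (if n - ?x < v \<and> v \<le> n - b0 then ?p else offset n g0 v)"
      if "v \<le> n" for v
      unfolding eq by (rule offset_update) (use IH Suc.prems that in auto)
    have init: "offset n g0 v = n" if "v \<le> n - b0" for v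
      by (rule offset_initial[OF IH(3) that])
    have "parent_edges n (offset n g) = ?N \<union> parent_edges n (offset n g0)" (is "?L = ?R")
    proof (intro equalityI subrelI)
      fix u v assume "(u, v) \<in> ?L"
      thus "(u, v) \<in> ?R"
        using upd[of v] by (auto simp: parent_edges_def split: if_splits)
    next
      fix u v assume "(u, v) \<in> ?R"
      thus "(u, v) \<in> ?L"
        using upd[of v] init[of v] by (auto simp: parent_edges_def split: if_splits)
    qed
    moreover have "equiv_closure (difference_edges n b0 (S \<union> m0) \<union> parent_edges n (offset n g0)) =
        equiv_closure (difference_edges n ?x (insert (?x + ?p) (S \<union> m0)) \<union> ?N \<union> parent_edges n (offset n g0))"
    proof (rule difference_edges_step)
      show "b0 < ?x" "?x < n" using IH(1) Suc.prems(1) by auto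
      show "?x \<in> S \<union> m0" by (rule True)
      show "y \<notin> S \<union> m0" if "b0 < y" "y < ?x" for y using IH(4)[of y] that by auto
    qed
    moreover have "S \<union> m = insert (?x + ?p) (S \<union> m0)" using eq by auto
    ultimately have "equiv_closure (difference_edges n 0 S) = equiv_closure (difference_edges n b (S \<union> m) \<union> parent_edges n (offset n g))"
      unfolding IH(5) eq(1) by (simp only: Un_assoc)
    moreover have "b \<le> Suc k" "g b \<noteq> 0" "\<forall>y > b. g y = 0" "\<forall>y \<in> S \<union> m. b < y \<longrightarrow> Suc k < y"
      using IH(1,3) eq by auto
    ultimately show ?thesis by blast
  qed
qed

lemma scan_parent_edges:
  assumes "0 < n" "scan S (n - 1) = (b, m, g)"
  shows "equiv_closure (difference_edges n 0 S) = equiv_closure (parent_edges n (offset n g))"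
proof -
  have "n - 1 < n" using assms(1) by simp
  note inv = scan_invariant[OF this assms(2)]
  have "b + (j - i) \<notin> S \<union> m" if "1 \<le> i" "i < j" "j \<le> n - b" for i j
  proof
    assume "b + (j - i) \<in> S \<union> m"
    hence "n - 1 < b + (j - i)" using inv that(2) by auto
    thus False using that by linarith
  qed
  hence "difference_edges n b (S \<union> m) = {}" by (auto simp: difference_edges_def)
  thus ?thesis using inv by simp
qed

section \<open>Labelling a forest\<close>

text \<open>In the following, \<open>d v\<close> is the distance from \<open>v\<close> to its parent, and \<open>v\<close> is a root if
  \<open>v \<le> d v\<close>.\<close>

definition roots :: "(nat \<Rightarrow> nat) \<Rightarrow> nat \<Rightarrow> nat" where
  "roots d v = card {u \<in> {1..v}. u \<le> d u}"

lemma roots_0 [simp]: "roots d 0 = 0"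
  by (simp add: roots_def)

lemma roots_Suc: "roots d (Suc v) = (if d (Suc v) < Suc v then roots d v else Suc (roots d v))"
proof -
  have "{u \<in> {1..Suc v}. u \<le> d u} =
      (if d (Suc v) < Suc v then {u \<in> {1..v}. u \<le> d u} else insert (Suc v) {u \<in> {1..v}. u \<le> d u})"
    by (auto simp: le_Suc_eq)
  thus ?thesis by (simp add: roots_def)
qed

lemma roots_mono: "u \<le> v \<Longrightarrow> roots d u \<le> roots d v"
  unfolding roots_def by (intro card_mono) auto

text \<open>A root gets its rank among the roots. The condition \<open>0 < d v\<close> makes the recursion descend.\<close>

function label :: "(nat \<Rightarrow> nat) \<Rightarrow> nat \<Rightarrow> nat" where
  "label d v = (if 0 < d v \<and> d v < v then label d (v - d v) else roots d v)"
  by auto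
termination by (relation "measure snd") auto

declare label.simps [simp del]

context
  fixes d :: "nat \<Rightarrow> nat"
  assumes d_pos: "\<And>v. 0 < d v"
begin

lemma label_less: "d v < v \<Longrightarrow> label d v = label d (v - d v)"
  using d_pos by (subst label.simps) auto

lemma label_root: "v \<le> d v \<Longrightarrow> label d v = roots d v"
  by (subst label.simps) auto

lemma label_bounds: "1 \<le> v \<Longrightarrow> 1 \<le> label d v \<and> label d v \<le> roots d v"
proof (induction v rule: less_induct)
  case (less v)
  show ?case
  proof (cases "d v < v")
    case True
    hence "1 \<le> label d (v - d v) \<and> label d (v - d v) \<le> roots d (v - d v)"
      using d_pos[of v] by (intro less.IH) linarith+
    moreover have "roots d (v - d v) \<le> roots d v" by (rule roots_mono) simp
    ultimately show ?thesis using True by (simp add: label_less)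
  next
    case False
    thus ?thesis using less.prems roots_Suc[of d "v - 1"] by (auto simp: label_root)
  qed
qed

lemma exists_label: "1 \<le> i \<Longrightarrow> i \<le> roots d v \<Longrightarrow> \<exists>u. 1 \<le> u \<and> u \<le> v \<and> label d u = i"
proof (induction v)
  case (Suc v)
  show ?case
  proof (cases "i \<le> roots d v")
    case True
    thus ?thesis using Suc by (auto intro: le_SucI)
  next
    case False
    hence "\<not> d (Suc v) < Suc v" "i = roots d (Suc v)" using Suc.prems
      by (auto simp: roots_Suc split: if_splits)
    thus ?thesis by (intro exI[of _ "Suc v"]) (auto simp: label_root)
  qed
qed simp

text \<open>Every vertex leads to a root of the same label; as distinct roots have distinct ranks, the label
  determines the tree.\<close>

lemma root_of_label:
  "1 \<le> v \<Longrightarrow> v \<le> n \<Longrightarrow> \<exists>r. 1 \<le> r \<and> r \<le> v \<and> r \<le> d r \<and> label d v = roots d r \<and> (v, r) \<in> equiv_closure (parent_edges n d)"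
proof (induction v rule: less_induct)
  case (less v)
  show ?case
  proof (cases "d v < v")
    case True
    have "(v, v - d v) \<in> equiv_closure (parent_edges n d)"
      by (rule equiv_closure_sym, rule equiv_closure_base) (use True less.prems in \<open>auto simp: parent_edges_def\<close>)
    moreover obtain r where "1 \<le> r" "r \<le> v - d v" "r \<le> d r" "label d (v - d v) = roots d r"
      "(v - d v, r) \<in> equiv_closure (parent_edges n d)"
    proof -
      have "v - d v < v" "1 \<le> v - d v" "v - d v \<le> n" using True d_pos[of v] less.prems by linarith+
      from less.IH[OF this] that show ?thesis by blast
    qed
    ultimately show ?thesis using True by (intro exI[of _ r]) (auto simp: label_less intro: equiv_closure_trans)
  next
    case False
    thus ?thesis using less.prems by (intro exI[of _ v]) (auto simp: label_root)
  qed
qed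

lemma roots_strict: "u < v \<Longrightarrow> v \<le> d v \<Longrightarrow> roots d u < roots d v"
  using roots_mono[of u "v - 1" d] roots_Suc[of d "v - 1"] by (cases v) auto

lemma label_eq_iff:
  assumes "1 \<le> u" "u \<le> n" "1 \<le> v" "v \<le> n"
  shows "label d u = label d v \<longleftrightarrow> (u, v) \<in> equiv_closure (parent_edges n d)"
proof
  assume eq: "label d u = label d v"
  from root_of_label[OF assms(1,2)] obtain r where
    r: "r \<le> d r" "label d u = roots d r" "(u, r) \<in> equiv_closure (parent_edges n d)" by auto
  from root_of_label[OF assms(3,4)] obtain q where
    q: "q \<le> d q" "label d v = roots d q" "(v, q) \<in> equiv_closure (parent_edges n d)" by auto
  have "r = q" using roots_strict[of r q] roots_strict[of q r] r q eq by (cases r q rule: linorder_cases) auto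
  thus "(u, v) \<in> equiv_closure (parent_edges n d)" using r q by (blast intro: equiv_closure_sym equiv_closure_trans)
next
  assume "(u, v) \<in> equiv_closure (parent_edges n d)"
  thus "label d u = label d v" unfolding equiv_closure_def
    by (induction rule: rtrancl_induct) (auto simp: parent_edges_def label_less)
qed

end

section \<open>Permuted, irreducible and block diagonal matrices\<close>

definition mat_on :: "('a \<Rightarrow> 'a \<Rightarrow> real) \<Rightarrow> 'a list \<Rightarrow> real mat" where
  "mat_on f xs = mat (length xs) (length xs) (\<lambda>(i, j). f (xs ! i) (xs ! j))"

lemma mat_on_carrier [simp]: "mat_on f xs \<in> carrier_mat (length xs) (length xs)"
  by (simp add: mat_on_def)

lemma dim_mat_on [simp]: "dim_row (mat_on f xs) = length xs" "dim_col (mat_on f xs) = length xs"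
  by (simp_all add: mat_on_def)

lemma permuted_mat:
  fixes M :: "real mat"
  assumes M: "M \<in> carrier_mat n n" and \<pi>: "\<pi> permutes {..<n}"
    and P: "P = mat n n (\<lambda>(i, j). if i = \<pi> j then 1 else 0)"
  shows "transpose_mat P * M * P = mat n n (\<lambda>(i, j). M $$ (\<pi> i, \<pi> j))"
proof (rule eq_matI)
  fix i j assume "i < dim_row (mat n n (\<lambda>(i, j). M $$ (\<pi> i, \<pi> j)))"
    "j < dim_col (mat n n (\<lambda>(i, j). M $$ (\<pi> i, \<pi> j)))"
  hence ij: "i < n" "j < n" by auto
  have \<pi>_less: "\<pi> k < n" if "k < n" for k using permutes_in_image[OF \<pi>, of k] that by simp
  have left: "(transpose_mat P * M) $$ (i, k) = M $$ (\<pi> i, k)" if k: "k < n" for k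
  proof -
    have "(transpose_mat P * M) $$ (i, k) = (\<Sum>l = 0..<n. (if l = \<pi> i then 1 else 0) * M $$ (l, k))"
      using M ij k by (auto simp: P scalar_prod_def intro!: sum.cong)
    also have "\<dots> = (\<Sum>l = 0..<n. if l = \<pi> i then M $$ (\<pi> i, k) else 0)"
      by (intro sum.cong) auto
    finally show ?thesis using \<pi>_less[OF ij(1)] by simp
  qed
  have "(transpose_mat P * M * P) $$ (i, j) =
      (\<Sum>k = 0..<n. (transpose_mat P * M) $$ (i, k) * (if k = \<pi> j then 1 else 0))"
    using M ij by (auto simp: P scalar_prod_def intro!: sum.cong)
  also have "\<dots> = (\<Sum>k = 0..<n. if k = \<pi> j then M $$ (\<pi> i, k) else 0)"
    by (intro sum.cong) (auto simp: left)
  finally show "(transpose_mat P * M * P) $$ (i, j) = mat n n (\<lambda>(i, j). M $$ (\<pi> i, \<pi> j)) $$ (i, j)"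
    using \<pi>_less[OF ij(2)] ij by (simp add: sum.delta)
qed (use M in \<open>auto simp: P\<close>)

text \<open>A zero block in the lower left corner means that the indices of the first \<open>k\<close> columns form a
  proper subset closed under taking neighbours, which connectivity, here stated through closed
  sets, excludes.\<close>

lemma irreducible_mat_on:
  assumes xs: "xs \<noteq> []"
    and closed: "\<And>Y. Y \<noteq> {} \<Longrightarrow> Y \<subseteq> set xs \<Longrightarrow>
      (\<And>x y. x \<in> set xs \<Longrightarrow> y \<in> Y \<Longrightarrow> f x y \<noteq> 0 \<Longrightarrow> x \<in> Y) \<Longrightarrow> Y = set xs"
    and dist: "distinct xs"
  shows "irreducible_mat (mat_on f xs)"
  unfolding irreducible_mat_def
proof (intro conjI notI)
  assume "reducible_mat (mat_on f xs)"
  then obtain P k m A1 A12 A2 where km: "1 \<le> k" "1 \<le> m"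
    and carr: "A1 \<in> carrier_mat k k" "A12 \<in> carrier_mat k m" "A2 \<in> carrier_mat m m"
    and perm: "permutation_mat (length xs) P"
    and block: "transpose_mat P * mat_on f xs * P = four_block_mat A1 A12 (0\<^sub>m m k) A2"
    unfolding reducible_mat_def by auto
  from perm obtain \<pi> where \<pi>: "\<pi> permutes {..<length xs}"
    and P: "P = mat (length xs) (length xs) (\<lambda>(i, j). if i = \<pi> j then 1 else 0)"
    unfolding permutation_mat_def by auto
  note eq = permuted_mat[OF mat_on_carrier \<pi> P, of f, unfolded block]
  from arg_cong[OF eq, of dim_row] have len: "length xs = k + m" using carr by simp
  have \<pi>_less: "\<pi> i < length xs" if "i < length xs" for i
    using permutes_in_image[OF \<pi>, of i] that by simp
  have zero: "f (xs ! \<pi> i) (xs ! \<pi> j) = 0" if "k \<le> i" "i < k + m" "j < k" for i j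
  proof -
    have "mat_on f xs $$ (\<pi> i, \<pi> j) = four_block_mat A1 A12 (0\<^sub>m m k) A2 $$ (i, j)"
      using that km by (subst eq) (auto simp: len)
    also have "\<dots> = 0" using that carr by simp
    finally show ?thesis using \<pi>_less[of i] \<pi>_less[of j] that len by (simp add: mat_on_def)
  qed
  let ?Y = "(\<lambda>j. xs ! \<pi> j) ` {..<k}"
  have "?Y = set xs"
  proof (rule closed)
    show "?Y \<noteq> {}" using km(1) by (auto intro!: exI[of _ 0] simp: lessThan_empty_iff)
    show "?Y \<subseteq> set xs" using \<pi>_less len by auto
    fix x y assume x: "x \<in> set xs" and y: "y \<in> ?Y" and f: "f x y \<noteq> 0"
    from x obtain l where l: "l < length xs" "x = xs ! l" by (auto simp: in_set_conv_nth)
    from permutes_surj[OF \<pi>] obtain i where i: "l = \<pi> i" by (auto simp: surj_def)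
    hence "i < k + m" using permutes_in_image[OF \<pi>, of i] l len by simp
    thus "x \<in> ?Y" using zero[of i] y f l i by (cases "i < k") auto
  qed
  hence "length xs = card ?Y" using distinct_card[OF dist] by simp
  also have "\<dots> \<le> k" using card_image_le[of "{..<k}" "\<lambda>j. xs ! \<pi> j"] by simp
  finally show False using len km by simp
qed (use xs in \<open>auto simp: Suc_le_eq\<close>)

lemma mat_on_append:
  assumes "\<And>x y. x \<in> set xs \<Longrightarrow> y \<in> set ys \<Longrightarrow> f x y = 0 \<and> f y x = 0"
  shows "mat_on f (xs @ ys) = four_block_mat (mat_on f xs) (0\<^sub>m (length xs) (length ys))
    (0\<^sub>m (length ys) (length xs)) (mat_on f ys)"
  by (rule eq_matI) (auto simp: mat_on_def nth_append assms)

lemma diag_block_mat_on: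
  assumes "\<And>i j x y. i < length Ls \<Longrightarrow> j < length Ls \<Longrightarrow> i \<noteq> j \<Longrightarrow> x \<in> set (Ls ! i) \<Longrightarrow>
    y \<in> set (Ls ! j) \<Longrightarrow> f x y = 0"
  shows "diag_block_mat (map (mat_on f) Ls) = mat_on f (concat Ls)"
  using assms
proof (induction Ls)
  case Nil
  show ?case by (auto simp: mat_on_def)
next
  case (Cons xs Ls)
  have IH: "diag_block_mat (map (mat_on f) Ls) = mat_on f (concat Ls)"
    using Cons.prems[of "Suc _" "Suc _"] by (intro Cons.IH) auto
  have "f x y = 0 \<and> f y x = 0" if "x \<in> set xs" "y \<in> set (concat Ls)" for x y
  proof -
    from that obtain j where j: "j < length Ls" "y \<in> set (Ls ! j)"
      unfolding set_concat by (metis UN_E in_set_conv_nth)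
    show ?thesis
      using Cons.prems[of 0 "Suc j" x y] Cons.prems[of "Suc j" 0 y x] j that by auto
  qed
  hence "mat_on f (concat (xs # Ls)) = four_block_mat (mat_on f xs)
    (0\<^sub>m (length xs) (length (concat Ls))) (0\<^sub>m (length (concat Ls)) (length xs)) (mat_on f (concat Ls))"
    by (simp only: concat.simps) (rule mat_on_append)
  thus ?case by (simp add: IH Let_def)
qed

lemma permuted_mat_on:
  assumes dist: "distinct ys" and set: "set ys = {1..n}"
  shows "\<exists>P. permutation_mat n P \<and> transpose_mat P * mat_on f [1..<Suc n] * P = mat_on f ys"
proof -
  have len: "length ys = n" using distinct_card[OF dist] set by simp
  define \<pi> where "\<pi> j = (if j < n then ys ! j - 1 else j)" for j
  have range: "1 \<le> ys ! j \<and> ys ! j \<le> n" if "j < n" for j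
    using nth_mem[of j ys] that set len by auto
  have inj: "inj_on \<pi> {..<n}"
  proof (rule inj_onI)
    fix i j assume "i \<in> {..<n}" "j \<in> {..<n}" "\<pi> i = \<pi> j"
    hence "ys ! i = ys ! j" "i < n" "j < n" using range[of i] range[of j] by (auto simp: \<pi>_def)
    thus "i = j" using dist len by (simp add: nth_eq_iff_index_eq)
  qed
  have "\<pi> ` {..<n} \<subseteq> {..<n}" using range by (force simp: \<pi>_def)
  with inj have "bij_betw \<pi> {..<n} {..<n}"
    by (metis bij_betw_def endo_inj_surj finite_lessThan)
  hence \<pi>: "\<pi> permutes {..<n}" by (rule bij_imp_permutes) (auto simp: \<pi>_def)
  define P :: "real mat" where "P = mat n n (\<lambda>(i, j). if i = \<pi> j then 1 else 0)"
  have "transpose_mat P * mat_on f [1..<Suc n] * P =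
      mat n n (\<lambda>(i, j). mat_on f [1..<Suc n] $$ (\<pi> i, \<pi> j))"
    by (rule permuted_mat[OF _ \<pi> P_def]) (metis mat_on_carrier length_upt diff_Suc_1)
  also have "\<dots> = mat_on f ys"
  proof (rule eq_matI)
    fix i j assume "i < dim_row (mat_on f ys)" "j < dim_col (mat_on f ys)"
    hence ij: "i < n" "j < n" using len by auto
    have "[1..<Suc n] ! \<pi> i = ys ! i" if "i < n" for i
    proof -
      have "1 + \<pi> i = ys ! i" "1 + \<pi> i < Suc n" using range[OF that] that by (simp_all add: \<pi>_def)
      thus ?thesis using nth_upt[of 1 "\<pi> i" "Suc n"] by simp
    qed
    moreover have "\<pi> i < n" "\<pi> j < n" using range[of i] range[of j] ij by (auto simp: \<pi>_def)
    ultimately show "mat n n (\<lambda>(i, j). mat_on f [1..<Suc n] $$ (\<pi> i, \<pi> j)) $$ (i, j) = mat_on f ys $$ (i, j)"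
      using ij len by (simp add: mat_on_def del: upt_Suc nth_upt)
  qed (auto simp: len)
  finally show ?thesis using \<pi> by (auto simp: permutation_mat_def P_def)
qed

section \<open>Components carry Toeplitz matrices\<close>

definition label_class :: "(nat \<Rightarrow> nat) \<Rightarrow> nat \<Rightarrow> nat \<Rightarrow> nat list" where
  "label_class \<rho> n i = filter (\<lambda>u. \<rho> u = i) [1..<Suc n]"

lemma set_label_class: "set (label_class \<rho> n i) = {u \<in> {1..n}. \<rho> u = i}"
  by (auto simp: label_class_def)

lemma sorted_label_class: "sorted_wrt (<) (label_class \<rho> n i)"
  unfolding label_class_def by (intro sorted_wrt_filter) (rule sorted_wrt_upt)

lemma distinct_label_class: "distinct (label_class \<rho> n i)"
  by (simp add: label_class_def)

lemma label_class_0 [simp]: "label_class \<rho> 0 i = []"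
  by (simp add: label_class_def)

lemma label_class_Suc:
  "label_class \<rho> (Suc v) i = label_class \<rho> v i @ (if \<rho> (Suc v) = i then [Suc v] else [])"
  by (simp add: label_class_def)

lemma length_label_class_le: "length (label_class \<rho> n i) \<le> n"
  unfolding label_class_def by (rule order_trans[OF length_filter_le]) simp

lemma sorted_succ_le:
  assumes "sorted_wrt (<) (xs :: nat list)" "Suc i < length xs" "y \<in> set xs" "xs ! i < y"
  shows "xs ! Suc i \<le> y"
proof -
  from assms(3) obtain j where j: "j < length xs" "y = xs ! j" by (auto simp: in_set_conv_nth)
  have "\<not> j < i" "j \<noteq> i" using sorted_wrt_nth_less[OF assms(1), of j i] assms j by auto
  thus ?thesis using sorted_wrt_nth_less[OF assms(1), of "Suc i" j] j by (cases "j = Suc i") auto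
qed

text \<open>Let \<open>x < y\<close> be elements of the set with \<open>f (y - x) \<noteq> 0\<close>, and let \<open>x'\<close>, \<open>y'\<close> be their successors. Put \<open>q = y - x\<close>.
  Closure puts \<open>y' - q\<close> into the set; it exceeds \<open>x\<close>, so \<open>x' \<le> y' - q\<close>. Then \<open>x' + q \<le> y' \<le> n\<close> lies
  in the set as well and exceeds \<open>y\<close>, so \<open>y' \<le> x' + q\<close>. Hence \<open>y' - x' = q\<close>. The same
  argument from \<open>(x', y')\<close> back to \<open>(x, y)\<close> covers \<open>f (y' - x') \<noteq> 0\<close>; otherwise both values are \<open>0\<close>.\<close>

lemma closed_entries_shift:
  fixes xs :: "nat list" and f :: "nat \<Rightarrow> real"
  assumes sorted: "sorted_wrt (<) xs" and set: "set xs \<subseteq> {1..n}"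
    and closed: "\<And>x y. x \<in> set xs \<Longrightarrow> y \<in> {1..n} \<Longrightarrow> f (nat \<bar>int x - int y\<bar>) \<noteq> 0 \<Longrightarrow> y \<in> set xs"
    and ij: "i \<le> j" "Suc j < length xs"
  shows "f (xs ! Suc j - xs ! Suc i) = f (xs ! j - xs ! i)"
proof (cases "i = j")
  case False
  hence "i < j" using ij by simp
  let ?x = "xs ! i" and ?x' = "xs ! Suc i" and ?y = "xs ! j" and ?y' = "xs ! Suc j"
  have less: "?x < ?x'" "?y < ?y'" "?x < ?y" "?x' < ?y'"
    using sorted_wrt_nth_less[OF sorted] \<open>i < j\<close> ij by auto
  have mem: "?x \<in> set xs" "?x' \<in> set xs" "?y \<in> set xs" "?y' \<in> set xs"
    using \<open>i < j\<close> ij by auto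
  have range: "1 \<le> ?x" "?y' \<le> n" using mem set by auto
  have up: "z + q \<in> set xs" if "f q \<noteq> 0" "z \<in> set xs" "z + q \<le> n" for z q
    by (rule closed[of z]) (use that set in auto)
  have down: "z - q \<in> set xs" if "f q \<noteq> 0" "z \<in> set xs" "q < z" for z q
    by (rule closed[of z]) (use that set in \<open>auto simp: nat_diff_distrib\<close>)
  have succ_x: "?x' \<le> z" if "z \<in> set xs" "?x < z" for z
    using sorted_succ_le[OF sorted _ that] \<open>i < j\<close> ij by simp
  have succ_y: "?y' \<le> z" if "z \<in> set xs" "?y < z" for z
    using sorted_succ_le[OF sorted _ that] ij by simp
  show ?thesis
  proof (cases "f (?y - ?x) = 0 \<and> f (?y' - ?x') = 0")
    case False
    have "?y' - ?x' = ?y - ?x"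
    proof (cases "f (?y - ?x) = 0")
      case False
      have "?x' \<le> ?y' - (?y - ?x)"
        by (rule succ_x[OF down[OF False mem(4)]]) (use less range in auto)
      moreover from this have "?y' \<le> ?x' + (?y - ?x)"
        by (intro succ_y[OF up[OF False mem(2)]]) (use less range in auto)
      ultimately show ?thesis using less by linarith
    next
      case True
      hence q: "f (?y' - ?x') \<noteq> 0" using False by simp
      define q where "q = ?y' - ?x'"
      note q = q[folded q_def]
      have q': "?y' = ?x' + q" using less by (simp add: q_def)
      have 1: "?x + q \<le> ?y"
      proof (rule ccontr)
        assume "\<not> ?thesis"
        hence "?y' \<le> ?x + q" using range q' less by (intro succ_y[OF up[OF q mem(1)]]) auto
        thus False using q' less by simp
      qed
      have "?y \<le> ?x + q"
      proof (rule ccontr)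
        assume *: "\<not> ?thesis"
        hence "?x' \<le> ?y - q" by (intro succ_x[OF down[OF q mem(3)]]) auto
        thus False using q' less * by simp
      qed
      with 1 show ?thesis using less q_def by simp
    qed
    thus ?thesis by simp
  qed simp
qed simp

lemma closed_class_toeplitz:
  fixes xs :: "nat list" and a :: "real list"
  assumes sorted: "sorted_wrt (<) xs" and set: "set xs \<subseteq> {1..n}"
    and closed: "\<And>x y. x \<in> set xs \<Longrightarrow> y \<in> {1..n} \<Longrightarrow> a ! nat \<bar>int x - int y\<bar> \<noteq> 0 \<Longrightarrow> y \<in> set xs"
  shows "toeplitz_mat (map (\<lambda>u. a ! (u - hd xs)) xs) = mat_on (\<lambda>u v. a ! nat \<bar>int u - int v\<bar>) xs"
proof -
  have base: "a ! (xs ! (i + k) - xs ! i) = a ! (xs ! k - xs ! 0)" if "i + k < length xs" for i k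
    using that
  proof (induction i)
    case (Suc i)
    thus ?case
      using closed_entries_shift[where f = "(!) a" and i = i and j = "i + k", OF sorted set closed] by simp
  qed simp
  have ge: "xs ! i \<le> xs ! j" if "i \<le> j" "j < length xs" for i j
    using sorted_wrt_nth_less[OF sorted, of i j] that by (cases "i = j") auto
  have *: "a ! nat \<bar>int (xs ! i) - int (xs ! j)\<bar> = a ! (xs ! nat \<bar>int i - int j\<bar> - xs ! 0)"
    if "i < length xs" "j < length xs" for i j
  proof (cases "i \<le> j")
    case True
    hence "nat \<bar>int (xs ! i) - int (xs ! j)\<bar> = xs ! j - xs ! i" "nat \<bar>int i - int j\<bar> = j - i"
      using ge[OF True that(2)] by auto
    thus ?thesis using base[of i "j - i"] that True by (simp only: le_add_diff_inverse)
  next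
    case False
    hence "nat \<bar>int (xs ! i) - int (xs ! j)\<bar> = xs ! i - xs ! j" "nat \<bar>int i - int j\<bar> = i - j"
      using ge[of j i] that by auto
    thus ?thesis using base[of j "i - j"] that False by (simp only: le_add_diff_inverse[of j i] not_le less_imp_le)
  qed
  have "hd xs = xs ! 0" if "i < length xs" for i
    using that by (intro hd_conv_nth) auto
  thus ?thesis
    by (intro eq_matI) (auto simp: toeplitz_mat_def mat_on_def * nat_less_iff)
qed

lemma distinct_concat_classes: "distinct is \<Longrightarrow> distinct (concat (map (label_class \<rho> n) is))"
  by (induction "is") (auto simp: set_label_class distinct_label_class)

lemma toeplitz_graph_sel [simp]:
  "verts (toeplitz_graph a) = {1..length a}"
  "(u, v) \<in> edges (toeplitz_graph a) \<longleftrightarrow>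
    u \<in> {1..length a} \<and> v \<in> {1..length a} \<and> a ! nat \<bar>int u - int v\<bar> \<noteq> 0"
  by (auto simp: toeplitz_graph_def toeplitz_support_def)

lemma rtrancl_toeplitz_edges:
  "(edges (toeplitz_graph a))\<^sup>* = equiv_closure (difference_edges (length a) 0 (toeplitz_support a))"
  unfolding equiv_closure_def
proof (rule rtrancl_subset)
  let ?E = "difference_edges (length a) 0 (toeplitz_support a)"
  show "?E \<union> ?E\<inverse> \<subseteq> edges (toeplitz_graph a)"
    by (auto simp: difference_edges_def toeplitz_support_def nat_diff_distrib)
  show "edges (toeplitz_graph a) \<subseteq> (?E \<union> ?E\<inverse>)\<^sup>*"
  proof (rule subrelI)
    fix u v assume "(u, v) \<in> edges (toeplitz_graph a)"
    hence uv: "u \<in> {1..length a}" "v \<in> {1..length a}" "a ! nat \<bar>int u - int v\<bar> \<noteq> 0" by auto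
    consider "u = v" | "u < v" | "v < u" by linarith
    hence "u = v \<or> (u, v) \<in> ?E \<union> ?E\<inverse>"
    proof cases
      case 2
      hence "nat \<bar>int u - int v\<bar> = v - u" by simp
      thus ?thesis using uv 2 by (auto simp: difference_edges_def toeplitz_support_def)
    next
      case 3
      hence "nat \<bar>int u - int v\<bar> = u - v" by simp
      thus ?thesis using uv 3 by (auto simp: difference_edges_def toeplitz_support_def)
    qed simp
    thus "(u, v) \<in> (?E \<union> ?E\<inverse>)\<^sup>*" by auto
  qed
qed

text \<open>All that the output has to satisfy follows once the labels identify the components; the rest of
  the development only computes such labels and copies entries accordingly.\<close>

lemma labelling_correct:
  fixes a :: "real list" and \<rho> :: "nat \<Rightarrow> nat"
  defines "G \<equiv> toeplitz_graph a" and "n \<equiv> length a"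
  assumes range: "\<And>u. u \<in> {1..n} \<Longrightarrow> \<rho> u \<in> {1..c}"
    and surj: "\<And>i. i \<in> {1..c} \<Longrightarrow> \<exists>u \<in> {1..n}. \<rho> u = i"
    and conn: "\<And>u v. u \<in> {1..n} \<Longrightarrow> v \<in> {1..n} \<Longrightarrow> \<rho> u = \<rho> v \<longleftrightarrow> (u, v) \<in> (edges G)\<^sup>*"
  shows "card (components G) = c" and "component_index_sequence G c \<rho>"
    and "frobenius_normal_form (toeplitz_mat a)
      (map (\<lambda>i. toeplitz_mat (map (\<lambda>u. a ! (u - hd (label_class \<rho> n i))) (label_class \<rho> n i))) [1..<Suc c])"
proof -
  have rel: "connected_rel G = {(u, v). u \<in> {1..n} \<and> v \<in> {1..n} \<and> \<rho> u = \<rho> v}"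
    using conn by (auto simp: connected_rel_def G_def n_def)
  have comps: "components G = (\<lambda>i. {u \<in> {1..n}. \<rho> u = i}) ` {1..c}"
  proof (intro equalityI subsetI)
    fix K assume "K \<in> components G"
    then obtain u where "u \<in> {1..n}" "K = connected_rel G `` {u}"
      by (auto simp: components_def G_def n_def elim!: quotientE)
    thus "K \<in> (\<lambda>i. {u \<in> {1..n}. \<rho> u = i}) ` {1..c}"
      using range[of u] by (intro image_eqI[of _ _ "\<rho> u"]) (auto simp only: rel)
  next
    fix K assume "K \<in> (\<lambda>i. {u \<in> {1..n}. \<rho> u = i}) ` {1..c}"
    then obtain i where i: "i \<in> {1..c}" "K = {u \<in> {1..n}. \<rho> u = i}" by auto
    from surj[OF i(1)] obtain u where u: "u \<in> {1..n}" "\<rho> u = i" by auto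
    hence "K = connected_rel G `` {u}" using i by (auto simp: rel)
    moreover have "u \<in> verts G" using u by (simp add: G_def n_def)
    ultimately show "K \<in> components G" by (auto simp: components_def intro: quotientI)
  qed
  have "inj_on (\<lambda>i. {u \<in> {1..n}. \<rho> u = i}) {1..c}"
  proof (rule inj_onI)
    fix i j assume "i \<in> {1..c}" and eq: "{u \<in> {1..n}. \<rho> u = i} = {u \<in> {1..n}. \<rho> u = j}"
    from surj[OF this(1)] obtain u where "u \<in> {1..n}" "\<rho> u = i" by auto
    thus "i = j" using eq by blast
  qed
  thus "card (components G) = c" by (simp add: comps card_image)
  show "component_index_sequence G c \<rho>"
    unfolding component_index_sequence_def comps using range by (auto simp: G_def n_def)

  define f where "f u v = a ! nat \<bar>int u - int v\<bar>" for u v :: nat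
  let ?L = "label_class \<rho> n"
  have f_sym: "f u v = f v u" for u v
  proof -
    have "\<bar>int u - int v\<bar> = \<bar>int v - int u\<bar>" by linarith
    thus ?thesis by (simp add: f_def)
  qed
  have edge: "\<rho> u = \<rho> v" if "f u v \<noteq> 0" "u \<in> {1..n}" "v \<in> {1..n}" for u v
    using conn[OF that(2,3)] that by (auto simp: G_def n_def f_def)
  have toep: "toeplitz_mat (map (\<lambda>u. a ! (u - hd (?L i))) (?L i)) = mat_on f (?L i)" for i
    unfolding f_def
    by (rule closed_class_toeplitz[where n = n, OF sorted_label_class])
      (use edge in \<open>auto simp: set_label_class f_def\<close>)
  have whole: "toeplitz_mat a = mat_on f [1..<Suc n]"
    by (rule eq_matI) (auto simp: toeplitz_mat_def mat_on_def f_def n_def simp del: upt_Suc)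
  have blocks: "diag_block_mat (map (mat_on f) (map ?L [1..<Suc c])) = mat_on f (concat (map ?L [1..<Suc c]))"
  proof (rule diag_block_mat_on)
    fix i j x y assume *: "i < length (map ?L [1..<Suc c])" "j < length (map ?L [1..<Suc c])" "i \<noteq> j"
      "x \<in> set (map ?L [1..<Suc c] ! i)" "y \<in> set (map ?L [1..<Suc c] ! j)"
    hence "x \<in> {1..n}" "y \<in> {1..n}" "\<rho> x = Suc i" "\<rho> y = Suc j"
      by (auto simp: set_label_class simp del: upt_Suc)
    thus "f x y = 0" using edge[of x y] * by auto
  qed
  have irred: "irreducible_mat (mat_on f (?L i))" if i: "i \<in> {1..c}" for i
  proof (rule irreducible_mat_on)
    show "?L i \<noteq> []" using surj[OF i] set_label_class[of \<rho> n i] by force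
    show "distinct (?L i)" by (rule distinct_label_class)
    fix Y assume Y: "Y \<noteq> {}" "Y \<subseteq> set (?L i)"
      and closed: "\<And>x y. x \<in> set (?L i) \<Longrightarrow> y \<in> Y \<Longrightarrow> f x y \<noteq> 0 \<Longrightarrow> x \<in> Y"
    from Y obtain u where u: "u \<in> Y" "u \<in> {1..n}" "\<rho> u = i" by (auto simp: set_label_class)
    have "v \<in> Y" if "(u, v) \<in> (edges G)\<^sup>*" for v
      using that
    proof (induction rule: rtrancl_induct)
      case (step y z)
      hence yz: "y \<in> {1..n}" "z \<in> {1..n}" "f y z \<noteq> 0" by (auto simp: G_def n_def f_def)
      moreover have "\<rho> y = i" using step.IH Y by (auto simp: set_label_class)
      ultimately show ?case
        using closed[of z y] step.IH edge[of y z] f_sym[of z y] by (auto simp: set_label_class)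
    qed (rule u)
    hence "v \<in> Y" if "v \<in> set (?L i)" for v
      using that u conn[of u v] by (auto simp: set_label_class)
    thus "Y = set (?L i)" using Y by blast
  qed
  have "transpose_mat (mat_on f xs) = mat_on f xs" for xs
    by (rule eq_matI) (auto simp: mat_on_def f_sym)
  moreover have "\<exists>P. permutation_mat n P \<and> transpose_mat P * mat_on f [1..<Suc n] * P =
      mat_on f (concat (map ?L [1..<Suc c]))"
    proof (rule permuted_mat_on)
    show "distinct (concat (map ?L [1..<Suc c]))" by (rule distinct_concat_classes) simp
    show "set (concat (map ?L [1..<Suc c])) = {1..n}" using range by (force simp: set_label_class)
  qed
  ultimately show "frobenius_normal_form (toeplitz_mat a)
      (map (\<lambda>i. toeplitz_mat (map (\<lambda>u. a ! (u - hd (?L i))) (?L i))) [1..<Suc c])"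
    using irred unfolding frobenius_normal_form_def whole toep blocks[symmetric]
    by (simp add: comp_def del: upt_Suc) 
qed

section \<open>Timed reachability of machine states\<close>

text \<open>The word bound is demanded of the states after the start, so that each rule has to check only
  the state that it produces.\<close>

definition reaches :: "program \<Rightarrow> nat \<Rightarrow> nat \<Rightarrow> config \<Rightarrow> (config \<Rightarrow> bool) \<Rightarrow> bool" where
  "reaches P B t s Q \<longleftrightarrow>
    (\<exists>k \<le> t. Q ((step P ^^ k) s) \<and> (\<forall>j. 0 < j \<and> j \<le> k \<longrightarrow> words_at_most B ((step P ^^ j) s)))"

lemma reaches_stop: "Q s \<Longrightarrow> reaches P B t s Q"
  by (auto simp: reaches_def intro: exI[of _ 0])

lemma reaches_mono: "reaches P B t s Q \<Longrightarrow> t \<le> t' \<Longrightarrow> (\<And>s. Q s \<Longrightarrow> Q' s) \<Longrightarrow> reaches P B t' s Q'"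
  unfolding reaches_def by (meson le_trans)

lemma reaches_trans:
  assumes "reaches P B t s R" and "\<And>s'. R s' \<Longrightarrow> reaches P B t' s' Q"
  shows "reaches P B (t + t') s Q"
proof -
  from assms(1) obtain k where k: "k \<le> t" "R ((step P ^^ k) s)"
    "\<And>j. 0 < j \<Longrightarrow> j \<le> k \<Longrightarrow> words_at_most B ((step P ^^ j) s)" by (auto simp: reaches_def)
  from assms(2)[OF k(2)] obtain l where l: "l \<le> t'" "Q ((step P ^^ l) ((step P ^^ k) s))"
    "\<And>j. 0 < j \<Longrightarrow> j \<le> l \<Longrightarrow> words_at_most B ((step P ^^ j) ((step P ^^ k) s))" by (auto simp: reaches_def)
  have shift: "(step P ^^ j) ((step P ^^ k) s) = (step P ^^ (k + j)) s" for j
    by (simp add: funpow_add add.commute[of k])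
  have "words_at_most B ((step P ^^ j) s)" if "0 < j" "j \<le> k + l" for j
  proof (cases "j \<le> k")
    case False
    thus ?thesis using l(3)[of "j - k"] that shift[of "j - k"] by simp
  qed (use k(3) that in simp)
  thus ?thesis using k(1) l(1,2) unfolding reaches_def shift by (intro exI[of _ "k + l"]) auto
qed

text \<open>Symbolic execution of one instruction on an explicitly given state. Started with a time bound equal to the
  number of instructions on a given path, iterated application of this rule runs the path and stops
  at its end, where the premise \<open>t \<noteq> 0\<close> fails.\<close>

lemma reaches_step:
  assumes "t \<noteq> 0" "i < length P"
    and "exec (P ! i) \<lparr>pc = i, reg = r, mem = m, entry = e\<rparr> = s'"
    and "words_at_most B s'" "reaches P B (t - 1) s' Q"
  shows "reaches P B t \<lparr>pc = i, reg = r, mem = m, entry = e\<rparr> Q"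
proof -
  have "reaches P B 1 \<lparr>pc = i, reg = r, mem = m, entry = e\<rparr> (\<lambda>s. s = s')"
    using assms(2-4) by (auto simp: reaches_def step_def halted_def le_Suc_eq intro!: exI[of _ 1])
  from reaches_trans[OF this, of "t - 1" Q] show ?thesis using assms(1,5) by simp
qed

lemma reaches_loop:
  assumes "\<And>i s. i < k \<Longrightarrow> I i s \<Longrightarrow> reaches P B t s (I (Suc i))"
  shows "I 0 s \<Longrightarrow> reaches P B (k * t) s (I k)"
  using assms
proof (induction k)
  case 0
  thus ?case by (auto intro: reaches_stop)
next
  case (Suc k)
  have "reaches P B (k * t + t) s (I (Suc k))"
    by (rule reaches_trans[OF Suc.IH]) (use Suc.prems in auto)
  thus ?case by (simp add: add.commute)
qed

lemma reaches_computes: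
  assumes "reaches P B t s Q" "words_at_most B s" "\<And>s'. Q s' \<Longrightarrow> halted P s'"
  shows "\<exists>s'. computes_within P t B s s' \<and> Q s'"
proof -
  from assms(1) obtain k where k: "k \<le> t" "Q ((step P ^^ k) s)"
    "\<And>j. 0 < j \<Longrightarrow> j \<le> k \<Longrightarrow> words_at_most B ((step P ^^ j) s)" by (auto simp: reaches_def)
  have "words_at_most B ((step P ^^ j) s)" if "j \<le> k" for j
    using k(3)[of j] assms(2) that by (cases "j = 0") auto
  thus ?thesis using k(1,2) assms(3) by (auto simp: computes_within_def)
qed

definition bounded_by :: "nat \<Rightarrow> (nat \<Rightarrow> nat) \<Rightarrow> bool" where
  "bounded_by B f \<longleftrightarrow> (\<forall>i. f i \<le> B)"

lemma words_at_most_iff [simp]: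
  "words_at_most B \<lparr>pc = i, reg = r, mem = m, entry = e\<rparr> \<longleftrightarrow> bounded_by B r \<and> bounded_by B m"
  by (simp add: words_at_most_def bounded_by_def)

lemma bounded_by_upd [simp]: "bounded_by B f \<Longrightarrow> x \<le> B \<Longrightarrow> bounded_by B (f(i := x))"
  by (simp add: bounded_by_def)

lemma bounded_byD: "bounded_by B f \<Longrightarrow> f i \<le> B"
  by (simp add: bounded_by_def)

section \<open>The program\<close>

text \<open>Constant registers: \<open>1\<close> holds \<open>n\<close>, \<open>6\<close> holds \<open>1\<close>, \<open>7\<close> holds \<open>0\<close>, and \<open>8\<close> to \<open>11\<close> hold the
  addresses below. Register \<open>0\<close> counts the components, \<open>2\<close> is the loop counter, \<open>3\<close> holds the base \<open>b\<close>,
  then the current offset, then the start of the current row; \<open>4\<close>, \<open>5\<close>, \<open>13\<close> are auxiliary. In the second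
  loop, register \<open>12\<close> is the position \<open>n + 1 - v\<close> that belongs to vertex \<open>v\<close>.

  Memory: labels at \<open>u\<close> and sizes of the components at \<open>n + i\<close>, as the output requires; marks at
  \<open>2 n + x\<close>, where \<open>x < 2 n\<close> because a step at \<open>x < n\<close> of length \<open>p \<le> x\<close> marks \<open>x + p\<close> without
  comparing it to \<open>n\<close>; step lengths at \<open>4 n + x\<close>; least vertices of the components at \<open>5 n + i\<close>;
  next free entry cells of the rows at \<open>6 n + i\<close>.

  Jump targets are absolute. The four loops begin at the instructions \<open>8\<close>, \<open>26\<close>, \<open>49\<close> and \<open>58\<close>.\<close>

definition toeplitz_program :: program where
  "toeplitz_program =
    [Move 1 0, Const 0 0, Const 6 1, Add 8 1 1, Add 9 8 8, Add 10 9 1, Add 11 10 1, Const 2 1,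
     \<comment> \<open>\<open>8\<close>: scan the positions; a nonzero entry skips the test of the mark\<close>
     Jump_Eq 2 1 23,
     Jump_Entry_Zero 2 11,
     Jump 14,
     Add 4 8 2, Load 5 4, Jump_Eq 5 7 21,
     \<comment> \<open>\<open>14\<close>: make a step\<close>
     Sub 5 2 3, Add 4 8 2, Add 4 4 5, Store 4 6, Add 4 9 2, Store 4 5, Move 3 2,
     Add 2 2 6, Jump 8,
     \<comment> \<open>\<open>23\<close>: label the vertices\<close>
     Move 3 1, Move 12 1, Const 2 1,
     Jump_Eq 12 7 47,
     Add 4 9 12, Load 5 4, Jump_Eq 5 7 31, Move 3 5,
     Jump_Less 3 2 37,
     \<comment> \<open>\<open>32\<close>: a root\<close>
     Add 0 0 6, Add 4 10 0, Store 4 2, Move 5 0, Jump 39,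
     \<comment> \<open>\<open>37\<close>: label of the parent\<close>
     Sub 4 2 3, Load 5 4,
     Store 2 5, Add 4 1 5, Load 13 4, Add 13 13 6, Store 4 13,
     Add 2 2 6, Sub 12 12 6, Jump 26,
     \<comment> \<open>\<open>47\<close>: starts of the rows as partial sums of the sizes\<close>
     Const 2 1, Move 3 1,
     Jump_Less 0 2 57,
     Add 4 11 2, Store 4 3, Add 4 1 2, Load 5 4, Add 3 3 5,
     Add 2 2 6, Jump 49,
     \<comment> \<open>\<open>57\<close>: copy the entries; \<open>70\<close> is the end of the program\<close>
     Const 2 1,
     Jump_Less 1 2 70,
     Load 4 2, Add 5 10 4, Load 5 5, Sub 5 2 5,
     Add 4 11 4, Load 13 4, Copy_Entry 13 5, Add 13 13 6, Store 4 13,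
     Add 2 2 6, Jump 58]"

text \<open>The part of the invariant common to all loops. The addresses reach \<open>7 n\<close>; the constant \<open>100\<close> is
  chosen to bound the running time as well.\<close>

definition workspace :: "nat \<Rightarrow> config \<Rightarrow> bool" where
  "workspace n s \<longleftrightarrow> words_at_most (100 * n) s \<and>
    reg s 1 = n \<and> reg s 6 = 1 \<and> reg s 7 = 0 \<and>
    reg s 8 = 2 * n \<and> reg s 9 = 4 * n \<and> reg s 10 = 5 * n \<and> reg s 11 = 6 * n"

section \<open>The four loops\<close>

definition scan_state :: "real list \<Rightarrow> nat \<Rightarrow> config \<Rightarrow> bool" where
  "scan_state a k s \<longleftrightarrow> (case scan (toeplitz_support a) k of (b, m, g) \<Rightarrow>
    let n = length a in
    pc s = 8 \<and> workspace n s \<and> reg s 0 = 0 \<and> reg s 2 = Suc k \<and> reg s 3 = b \<and>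
    (\<forall>x < n. entry s x = a ! x) \<and>
    (\<forall>i. 0 < i \<and> i < 2 * n \<longrightarrow> mem s (2 * n + i) = of_bool (i \<in> m)) \<and>
    (\<forall>i. 0 < i \<and> i \<le> n \<longrightarrow> mem s (4 * n + i) = g i) \<and>
    (\<forall>i \<le> 2 * n. mem s i = 0))"

lemmas exec_unfold = set_reg_def branch_def toeplitz_program_def

lemma scan_start:
  assumes "a \<noteq> []"
  shows "reaches toeplitz_program (100 * length a) 8 (initial_config (length a) a) (scan_state a 0)"
proof -
  have n: "Suc 0 \<le> length a" using assms by (simp add: Suc_le_eq)
  show ?thesis unfolding initial_config_def
    apply (rule reaches_step, simp, simp add: exec_unfold, simp add: exec_unfold, use n in \<open>simp add: bounded_by_def\<close>)+
    apply (rule reaches_stop)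
    using n by (simp add: scan_state_def workspace_def bounded_by_def)
qed

lemma scan_step:
  assumes k: "Suc k < length a" and s: "scan_state a k s"
  shows "reaches toeplitz_program (100 * length a) 14 s (scan_state a (Suc k))"
proof -
  let ?n = "length a" and ?S = "toeplitz_support a"
  obtain b m g where sc: "scan ?S k = (b, m, g)" by (metis prod_cases3)
  obtain i r h e where s_eq: "s = \<lparr>pc = i, reg = r, mem = h, entry = e\<rparr>" by (cases s) auto
  from s have i: "i = 8" and bnd: "bounded_by (100 * ?n) r" "bounded_by (100 * ?n) h"
    and r: "r 0 = 0" "r 1 = ?n" "r (Suc 0) = ?n" "r 2 = Suc k" "r 3 = b" "r 6 = 1" "r 7 = 0"
      "r 8 = 2 * ?n" "r 9 = 4 * ?n" "r 10 = 5 * ?n" "r 11 = 6 * ?n"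
    and e: "\<And>x. x < ?n \<Longrightarrow> e x = a ! x"
    and h: "\<And>i. 0 < i \<Longrightarrow> i < 2 * ?n \<Longrightarrow> h (2 * ?n + i) = of_bool (i \<in> m)"
      "\<And>i. 0 < i \<Longrightarrow> i \<le> ?n \<Longrightarrow> h (4 * ?n + i) = g i" "\<And>i. i \<le> 2 * ?n \<Longrightarrow> h i = 0"
    by (auto simp: s_eq sc scan_state_def workspace_def Let_def)
  from h(1)[of "Suc k"] k have mark: "h (2 * ?n + Suc k) = of_bool (Suc k \<in> m)" by simp
  from e[of "Suc k"] k have ex: "e (Suc k) = 0 \<longleftrightarrow> Suc k \<notin> ?S" by (auto simp: toeplitz_support_def)
  have b: "b \<le> k" using scan_invariant[OF _ sc, of ?n] k by simp
  consider "Suc k \<in> ?S" | "Suc k \<notin> ?S" "Suc k \<in> m" | "Suc k \<notin> ?S" "Suc k \<notin> m" by blast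
  thus ?thesis
  proof cases
    case 1
    have "reaches toeplitz_program (100 * ?n) 12 s (scan_state a (Suc k))"
      unfolding s_eq i
      apply (rule reaches_step, simp, simp add: exec_unfold,
         use 1 ex k in \<open>simp add: exec_unfold r bnd b\<close>,  use k b in \<open>simp add: bnd\<close>)+
      apply (rule reaches_stop)
      using 1 k b by (auto simp: scan_state_def workspace_def r bnd sc Let_def h e)
    thus ?thesis by (rule reaches_mono) auto
  next
    case 2
    show ?thesis
      unfolding s_eq i
      apply (rule reaches_step, simp, simp add: exec_unfold,
         use 2 ex mark k in \<open>simp add: exec_unfold r bnd b\<close>, use k b in \<open>simp add: bnd\<close>)+
      apply (rule reaches_stop)
      using 2 k b by (auto simp: scan_state_def workspace_def r bnd sc Let_def h e)
  next
    case 3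
    have "reaches toeplitz_program (100 * ?n) 7 s (scan_state a (Suc k))"
      unfolding s_eq i
      apply (rule reaches_step, simp, simp add: exec_unfold,
         use 3 ex mark k in \<open>simp add: exec_unfold r bnd b\<close>, use k b in \<open>simp add: bnd\<close>)+
      apply (rule reaches_stop)
      using 3 k b by (auto simp: scan_state_def workspace_def r bnd sc Let_def h e)
    thus ?thesis by (rule reaches_mono) auto
  qed
qed

text \<open>Of the scan, the recorded step lengths \<open>g\<close> suffice, since they determine the offsets. The vertex
  \<open>v\<close> is the last one that has its label.\<close>

definition label_state :: "real list \<Rightarrow> (nat \<Rightarrow> nat) \<Rightarrow> nat \<Rightarrow> config \<Rightarrow> bool" where
  "label_state a g v s \<longleftrightarrow> (let n = length a; d = offset n g in
    pc s = 26 \<and> workspace n s \<and> reg s 0 = roots d v \<and> reg s 2 = Suc v \<and> reg s 3 = d v \<and>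
    reg s 12 = n - v \<and>
    (\<forall>x < n. entry s x = a ! x) \<and>
    (\<forall>u. 1 \<le> u \<and> u \<le> v \<longrightarrow> mem s u = label d u) \<and>
    (\<forall>i. 1 \<le> i \<and> i \<le> n \<longrightarrow> mem s (n + i) = length (label_class (label d) v i)) \<and>
    (\<forall>i. 1 \<le> i \<and> i \<le> n \<longrightarrow> mem s (4 * n + i) = g i) \<and>
    (\<forall>i. 1 \<le> i \<and> i \<le> roots d v \<longrightarrow> mem s (5 * n + i) = hd (label_class (label d) v i)))"

lemma label_start:
  assumes n: "a \<noteq> []" and sc: "scan (toeplitz_support a) (length a - 1) = (b, m, g)"
    and s: "scan_state a (length a - 1) s"
  shows "reaches toeplitz_program (100 * length a) 4 s (label_state a g 0)"
proof -
  let ?n = "length a"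
  have n: "1 \<le> ?n" using n by (simp add: Suc_le_eq)
  obtain i r h e where s_eq: "s = \<lparr>pc = i, reg = r, mem = h, entry = e\<rparr>" by (cases s) auto
  from s have i: "i = 8" and bnd: "bounded_by (100 * ?n) r" "bounded_by (100 * ?n) h"
    and r: "r 0 = 0" "r 1 = ?n" "r (Suc 0) = ?n" "r 2 = ?n" "r 6 = 1" "r 7 = 0"
      "r 8 = 2 * ?n" "r 9 = 4 * ?n" "r 10 = 5 * ?n" "r 11 = 6 * ?n"
    and e: "\<And>x. x < ?n \<Longrightarrow> e x = a ! x"
    and h: "\<And>i. 0 < i \<Longrightarrow> i \<le> ?n \<Longrightarrow> h (4 * ?n + i) = g i" "\<And>i. i \<le> 2 * ?n \<Longrightarrow> h i = 0"
    using n by (auto simp: s_eq sc[unfolded One_nat_def] scan_state_def workspace_def Let_def)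
  show ?thesis
    unfolding s_eq i
    apply (rule reaches_step, simp, simp add: exec_unfold,
       simp add: exec_unfold r bnd, use n in \<open>simp add: bnd r\<close>)+
    apply (rule reaches_stop)
    using n by (auto simp: label_state_def workspace_def r bnd Let_def h e)
qed

lemma label_step:
  assumes v: "v < length a" and s: "label_state a g v s"
  shows "reaches toeplitz_program (100 * length a) 20 s (label_state a g (Suc v))"
proof -
  define n where "n = length a"
  define d where "d = offset n g"
  define l where "l = label d (Suc v)"
  have n: "1 \<le> n" "v < n" using v by (auto simp: n_def)
  define y where "y = n - v"
  have y: "0 < y" "y \<le> n" "y - Suc 0 = n - Suc v" using n by (auto simp: y_def)
  obtain i r h e where s_eq: "s = \<lparr>pc = i, reg = r, mem = h, entry = e\<rparr>" by (cases s) auto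
  from s have i: "i = 26" and bnd: "bounded_by (100 * n) r" "bounded_by (100 * n) h"
    and r: "r 0 = roots d v" "r 1 = n" "r (Suc 0) = n" "r 2 = Suc v" "r 3 = d v" "r 6 = 1" "r 7 = 0"
      "r 8 = 2 * n" "r 9 = 4 * n" "r 10 = 5 * n" "r 11 = 6 * n" "r 12 = y"
    and e: "\<And>x. x < n \<Longrightarrow> e x = a ! x"
    and h: "\<And>u. 1 \<le> u \<Longrightarrow> u \<le> v \<Longrightarrow> h u = label d u"
      "\<And>i. 1 \<le> i \<Longrightarrow> i \<le> n \<Longrightarrow> h (n + i) = length (label_class (label d) v i)"
      "\<And>i. 1 \<le> i \<Longrightarrow> i \<le> n \<Longrightarrow> h (4 * n + i) = g i"
      "\<And>i. 1 \<le> i \<Longrightarrow> i \<le> roots d v \<Longrightarrow> h (5 * n + i) = hd (label_class (label d) v i)"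
    by (auto simp: s_eq label_state_def workspace_def Let_def n_def d_def y_def)
  have d_pos: "0 < d u" for u unfolding d_def by (rule offset_pos) (use n in simp)
  have roots_le: "roots d v \<le> v"
    unfolding roots_def by (rule order_trans[OF card_mono[of "{1..v}"]]) auto
  have d_Suc: "d (Suc v) = (if g y \<noteq> 0 then g y else d v)" by (simp add: d_def y_def)
  have gap: "h (4 * n + y) = g y" by (rule h) (use y in auto)
  have l: "1 \<le> l" "l \<le> roots d (Suc v)" using label_bounds[of d "Suc v", OF d_pos] by (auto simp: l_def)
  have l_le: "l \<le> n" using l(2) roots_le n by (simp add: roots_Suc split: if_splits)
  have size: "h (n + l) = length (label_class (label d) v l)" by (rule h) (use l l_le in auto)
  note size_le = length_label_class_le[of "label d" v l]
  have old: "l \<le> roots d v" "h (Suc v - d (Suc v)) = l" if "d (Suc v) < Suc v"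
    using that l(2) h(1)[of "Suc v - d (Suc v)"] d_pos[of "Suc v"] label_less[of d, OF d_pos that]
    by (auto simp: roots_Suc l_def)
  have fresh: "l = Suc (roots d v)" "label_class (label d) v l = []" if "\<not> d (Suc v) < Suc v"
  proof -
    show l: "l = Suc (roots d v)" using label_root[of d "Suc v", OF d_pos] that by (simp add: l_def roots_Suc)
    have "label d u \<noteq> l" if "1 \<le> u" "u \<le> v" for u
      using label_bounds[of d, OF d_pos that(1)] roots_mono[OF that(2), of d] l by auto
    hence "\<forall>u \<in> set [1..<Suc v]. label d u \<noteq> l" by (auto simp del: upt_Suc)
    thus "label_class (label d) v l = []" unfolding label_class_def by (rule filter_False)
  qed
  have nonempty: "label_class (label d) v i \<noteq> []" if "1 \<le> i" "i \<le> roots d v" for i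
    using exists_label[of d, OF d_pos that] by (auto simp: label_class_def filter_empty_conv)
  have gap_bound: "g y \<le> 100 * n" using bounded_byD[OF bnd(2), of "4 * n + y"] gap by simp
  have d_bound: "d v \<le> 100 * n" using bounded_byD[OF bnd(1), of 3] r by simp
  \<comment> \<open>the memory after the iteration, which for a new component includes its least vertex\<close>
  define h' where "h' = (if d (Suc v) < Suc v then h else h(5 * n + l := Suc v))"
  define h'' where "h'' = h'(Suc v := l, n + l := Suc (length (label_class (label d) v l)))"
  have "h'' u = label d u" if "1 \<le> u" "u \<le> Suc v" for u
    using that h(1)[of u] n l by (auto simp: h''_def h'_def l_def)
  moreover have "h'' (n + i) = length (label_class (label d) (Suc v) i)" if "1 \<le> i" "i \<le> n" for i
    using that h(2)[of i] n l by (auto simp: h''_def h'_def l_def label_class_Suc)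
  moreover have "h'' (4 * n + i) = g i" if "1 \<le> i" "i \<le> n" for i
    using that h(3)[of i] n l l_le by (auto simp: h''_def h'_def)
  moreover have "h'' (5 * n + i) = hd (label_class (label d) (Suc v) i)"
    if "1 \<le> i" "i \<le> roots d (Suc v)" for i
  proof (cases "i \<le> roots d v")
    case True
    thus ?thesis using that h(4)[of i] n l_le nonempty[of i] fresh
      by (auto simp: h''_def h'_def label_class_Suc)
  next
    case False
    hence "\<not> d (Suc v) < Suc v" "i = l" using that fresh by (auto simp: roots_Suc split: if_splits)
    thus ?thesis using that n l_le fresh(2) by (simp add: h''_def h'_def label_class_Suc l_def)
  qed
  ultimately have final: "label_state a g (Suc v) \<lparr>pc = 26, reg = r', mem = h'', entry = e\<rparr>"
    if "bounded_by (100 * n) r'" "bounded_by (100 * n) h''" "r' 0 = roots d (Suc v)" "r' 1 = n" "r' 2 = Suc (Suc v)"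
      "r' 3 = d (Suc v)" "r' 6 = 1" "r' 7 = 0" "r' 8 = 2 * n" "r' 9 = 4 * n" "r' 10 = 5 * n"
      "r' 11 = 6 * n" "r' 12 = n - Suc v" for r'
    using that e by (auto simp: label_state_def workspace_def Let_def n_def d_def)
  have start: "reaches toeplitz_program (100 * n) 5 s (\<lambda>s'. \<exists>r'. 
      s' = \<lparr>pc = 31, reg = r', mem = h, entry = e\<rparr> \<and> bounded_by (100 * n) r' \<and> r' 3 = d (Suc v) \<and>
      (\<forall>p \<in> {0, 1, 2, 6, 7, 8, 9, 10, 11, 12}. r' p = r p))"
  proof (cases "g y = 0")
    case True
    have "reaches toeplitz_program (100 * n) 4 s (\<lambda>s'. \<exists>r'. 
      s' = \<lparr>pc = 31, reg = r', mem = h, entry = e\<rparr> \<and> bounded_by (100 * n) r' \<and> r' 3 = d (Suc v) \<and>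
      (\<forall>p \<in> {0, 1, 2, 6, 7, 8, 9, 10, 11, 12}. r' p = r p))"
      unfolding s_eq i
      apply (rule reaches_step, simp, simp add: exec_unfold,
         use n y(1) True in \<open>simp add: exec_unfold r bnd gap\<close>, use y in \<open>simp add: bnd gap_bound\<close>)+
      apply (rule reaches_stop)
      using True y(2) by (auto simp: r bnd d_Suc)
    thus ?thesis by (rule reaches_mono) auto
  next
    case False
    show ?thesis
      unfolding s_eq i
      apply (rule reaches_step, simp, simp add: exec_unfold,
         use n y(1) False in \<open>simp add: exec_unfold r bnd gap\<close>, use y in \<open>simp add: bnd gap_bound\<close>)+
      apply (rule reaches_stop)
      using False y(2) by (auto simp: r bnd d_Suc gap_bound)
  qed
  have "reaches toeplitz_program (100 * n) 14 \<lparr>pc = 31, reg = q, mem = h, entry = e\<rparr> (label_state a g (Suc v))"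
    if q: "bounded_by (100 * n) q" "q 3 = d (Suc v)" "\<forall>p \<in> {0, 1, 2, 6, 7, 8, 9, 10, 11, 12}. q p = r p" for q
  proof -
    have qr: "q 0 = roots d v" "q 1 = n" "q (Suc 0) = n" "q 2 = Suc v" "q 6 = 1" "q 7 = 0"
      "q 8 = 2 * n" "q 9 = 4 * n" "q 10 = 5 * n" "q 11 = 6 * n" "q 12 = y"
      using q(3) r by auto
    show ?thesis
    proof (cases "d (Suc v) < Suc v")
      case True
      have "reaches toeplitz_program (100 * n) 11 \<lparr>pc = 31, reg = q, mem = h, entry = e\<rparr> (label_state a g (Suc v))"
        apply (rule reaches_step, simp, simp add: exec_unfold,
           use n y(1) True l l_le in \<open>simp add: exec_unfold q(2) qr size old(2)\<close>,
           use n y l l_le size_le in \<open>simp add: q(1) bnd\<close>)+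
        apply (rule reaches_stop)
        using True n l l_le size_le old size
        by (intro final[unfolded h''_def h'_def, simplified True if_True]) (simp_all add: q(1,2) qr bnd roots_Suc y)
      thus ?thesis by (rule reaches_mono) auto
    next
      case False
      note fr = fresh(1)[OF False, symmetric]
      show ?thesis
        apply (rule reaches_step, simp, simp add: exec_unfold,
           use n y(1) False l l_le fr in \<open>simp add: exec_unfold q(2) qr size\<close>,
           use n y l l_le size_le fr in \<open>simp add: q(1) bnd size\<close>)+
        apply (rule reaches_stop)
        using False n l l_le size_le fr size
        by (intro final[unfolded h''_def h'_def, simplified False if_False]) (simp_all add: q(1,2) qr bnd roots_Suc y)
    qed
  qed
  with start have "reaches toeplitz_program (100 * n) (5 + 14) s (label_state a g (Suc v))"
    by (elim reaches_trans) auto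
  thus ?thesis unfolding n_def by (rule reaches_mono) auto
qed

definition row_start :: "(nat \<Rightarrow> nat) \<Rightarrow> nat \<Rightarrow> nat \<Rightarrow> nat" where
  "row_start \<rho> n i = n + (\<Sum>j = 1..<i. length (label_class \<rho> n j))"

lemma row_start_Suc: "1 \<le> i \<Longrightarrow> row_start \<rho> n (Suc i) = row_start \<rho> n i + length (label_class \<rho> n i)"
  by (simp add: row_start_def)

lemma row_start_mono: "i \<le> j \<Longrightarrow> row_start \<rho> n i \<le> row_start \<rho> n j"
  by (auto simp: row_start_def intro!: sum_mono2)

text \<open>The classes are disjoint parts of \<open>{1..n}\<close>, so the rows occupy at most \<open>n\<close> entry cells.\<close>

lemma row_start_le: "row_start \<rho> n i \<le> 2 * n"
proof -
  let ?xs = "concat (map (label_class \<rho> n) [1..<i])"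
  have "length ?xs = card (set ?xs)"
    by (rule distinct_card[symmetric]) (simp add: distinct_concat_classes)
  also have "\<dots> \<le> card {1..n}" by (intro card_mono) (auto simp: set_label_class)
  finally have "length ?xs \<le> n" by simp
  moreover have "length ?xs = (\<Sum>j = 1..<i. length (label_class \<rho> n j))"
    by (simp add: length_concat comp_def sum_list_distinct_conv_sum_set)
  ultimately show ?thesis by (simp add: row_start_def)
qed

definition sums_state :: "real list \<Rightarrow> (nat \<Rightarrow> nat) \<Rightarrow> nat \<Rightarrow> nat \<Rightarrow> config \<Rightarrow> bool" where
  "sums_state a \<rho> c i s \<longleftrightarrow> (let n = length a in
    pc s = 49 \<and> workspace n s \<and> reg s 0 = c \<and> reg s 2 = Suc i \<and> reg s 3 = row_start \<rho> n (Suc i) \<and>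
    (\<forall>x < n. entry s x = a ! x) \<and>
    (\<forall>u. 1 \<le> u \<and> u \<le> n \<longrightarrow> mem s u = \<rho> u) \<and>
    (\<forall>j. 1 \<le> j \<and> j \<le> n \<longrightarrow> mem s (n + j) = length (label_class \<rho> n j)) \<and>
    (\<forall>j. 1 \<le> j \<and> j \<le> c \<longrightarrow> mem s (5 * n + j) = hd (label_class \<rho> n j)) \<and>
    (\<forall>j. 1 \<le> j \<and> j \<le> i \<longrightarrow> mem s (6 * n + j) = row_start \<rho> n j))"

lemma sums_start:
  assumes n: "a \<noteq> []" and s: "label_state a g (length a) s"
  defines "d \<equiv> offset (length a) g"
  shows "reaches toeplitz_program (100 * length a) 3 s
    (sums_state a (label d) (roots d (length a)) 0)"
proof -
  define n where "n = length a"
  have n: "1 \<le> n" using n by (simp add: n_def Suc_le_eq)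
  obtain i r h e where s_eq: "s = \<lparr>pc = i, reg = r, mem = h, entry = e\<rparr>" by (cases s) auto
  from s have i: "i = 26" and bnd: "bounded_by (100 * n) r" "bounded_by (100 * n) h"
    and r: "r 0 = roots d n" "r 1 = n" "r (Suc 0) = n" "r 2 = Suc n" "r 6 = 1" "r 7 = 0"
      "r 8 = 2 * n" "r 9 = 4 * n" "r 10 = 5 * n" "r 11 = 6 * n" "r 12 = 0"
    and e: "\<And>x. x < n \<Longrightarrow> e x = a ! x"
    and h: "\<And>u. 1 \<le> u \<Longrightarrow> u \<le> n \<Longrightarrow> h u = label d u"
      "\<And>i. 1 \<le> i \<Longrightarrow> i \<le> n \<Longrightarrow> h (n + i) = length (label_class (label d) n i)"
      "\<And>i. 1 \<le> i \<Longrightarrow> i \<le> roots d n \<Longrightarrow> h (5 * n + i) = hd (label_class (label d) n i)"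
    by (auto simp: s_eq label_state_def workspace_def Let_def n_def d_def)
  show ?thesis
    unfolding s_eq i n_def[symmetric]
    apply (rule reaches_step, simp, simp add: exec_unfold,
       simp add: exec_unfold r bnd, use n in \<open>simp add: bnd r\<close>)+
    apply (rule reaches_stop)
    using n by (auto simp: sums_state_def workspace_def r bnd Let_def h e n_def[symmetric] row_start_def)
qed

lemma sums_step:
  assumes i: "i < c" and c: "c \<le> length a" and s: "sums_state a \<rho> c i s"
  shows "reaches toeplitz_program (100 * length a) 8 s (sums_state a \<rho> c (Suc i))"
proof -
  define n where "n = length a"
  define R where "R = row_start \<rho> n (Suc i)"
  define k where "k = length (label_class \<rho> n (Suc i))"
  have n: "Suc i \<le> n" using i c by (simp add: n_def)
  obtain p r h e where s_eq: "s = \<lparr>pc = p, reg = r, mem = h, entry = e\<rparr>" by (cases s) auto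
  from s have p: "p = 49" and bnd: "bounded_by (100 * n) r" "bounded_by (100 * n) h"
    and r: "r 0 = c" "r 1 = n" "r (Suc 0) = n" "r 2 = Suc i" "r 3 = R" "r 6 = 1" "r 7 = 0"
      "r 8 = 2 * n" "r 9 = 4 * n" "r 10 = 5 * n" "r 11 = 6 * n"
    and e: "\<And>x. x < n \<Longrightarrow> e x = a ! x"
    and h: "\<And>u. 1 \<le> u \<Longrightarrow> u \<le> n \<Longrightarrow> h u = \<rho> u"
      "\<And>j. 1 \<le> j \<Longrightarrow> j \<le> n \<Longrightarrow> h (n + j) = length (label_class \<rho> n j)"
      "\<And>j. 1 \<le> j \<Longrightarrow> j \<le> c \<Longrightarrow> h (5 * n + j) = hd (label_class \<rho> n j)"
      "\<And>j. 1 \<le> j \<Longrightarrow> j \<le> i \<Longrightarrow> h (6 * n + j) = row_start \<rho> n j"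
    by (auto simp: s_eq sums_state_def workspace_def Let_def n_def R_def)
  have size: "h (n + Suc i) = k" "h (Suc (n + i)) = k" using h(2)[of "Suc i"] n by (auto simp: k_def)
  have bounds: "R \<le> 2 * n" "k \<le> n" unfolding R_def k_def by (rule row_start_le, rule length_label_class_le)
  have next_start: "R + k = row_start \<rho> n (Suc (Suc i))" by (simp add: row_start_Suc[of "Suc i"] R_def k_def)
  show ?thesis
    unfolding s_eq p n_def[symmetric]
    apply (rule reaches_step, simp, simp add: exec_unfold,
       use n i in \<open>simp add: exec_unfold r bnd size\<close>, use n bounds in \<open>simp add: bnd r\<close>)+
    apply (rule reaches_stop)
    using n i bounds c row_start_le[of \<rho> n "Suc (Suc i)"] by (auto simp: sums_state_def workspace_def r bnd Let_def h e n_def[symmetric]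
       next_start R_def[symmetric] le_Suc_eq)
qed

text \<open>The vertices \<open>1, \<dots>, v\<close> have been copied. As they are visited in increasing order, each row is
  filled from left to right, and \<open>label_class \<rho> v j\<close> is the part of class \<open>j\<close> already dealt with.\<close>

definition copy_state :: "real list \<Rightarrow> (nat \<Rightarrow> nat) \<Rightarrow> nat \<Rightarrow> nat \<Rightarrow> config \<Rightarrow> bool" where
  "copy_state a \<rho> c v s \<longleftrightarrow> (let n = length a in
    pc s = 58 \<and> workspace n s \<and> reg s 0 = c \<and> reg s 2 = Suc v \<and>
    (\<forall>x < n. entry s x = a ! x) \<and>
    (\<forall>u. 1 \<le> u \<and> u \<le> n \<longrightarrow> mem s u = \<rho> u) \<and>
    (\<forall>j. 1 \<le> j \<and> j \<le> n \<longrightarrow> mem s (n + j) = length (label_class \<rho> n j)) \<and>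
    (\<forall>j. 1 \<le> j \<and> j \<le> c \<longrightarrow> mem s (5 * n + j) = hd (label_class \<rho> n j)) \<and>
    (\<forall>j. 1 \<le> j \<and> j \<le> c \<longrightarrow> mem s (6 * n + j) = row_start \<rho> n j + length (label_class \<rho> v j)) \<and>
    (\<forall>j t. 1 \<le> j \<and> j \<le> c \<and> t < length (label_class \<rho> v j) \<longrightarrow>
      entry s (row_start \<rho> n j + t) = a ! (label_class \<rho> v j ! t - hd (label_class \<rho> n j))))"

lemma copy_start:
  assumes n: "a \<noteq> []" and c: "c \<le> length a" and s: "sums_state a \<rho> c c s"
  shows "reaches toeplitz_program (100 * length a) 2 s (copy_state a \<rho> c 0)"
proof -
  define n where "n = length a"
  have n: "1 \<le> n" using n by (simp add: n_def Suc_le_eq)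
  obtain p r h e where s_eq: "s = \<lparr>pc = p, reg = r, mem = h, entry = e\<rparr>" by (cases s) auto
  from s have p: "p = 49" and bnd: "bounded_by (100 * n) r" "bounded_by (100 * n) h"
    and r: "r 0 = c" "r 1 = n" "r (Suc 0) = n" "r 2 = Suc c" "r 6 = 1" "r 7 = 0"
      "r 8 = 2 * n" "r 9 = 4 * n" "r 10 = 5 * n" "r 11 = 6 * n"
    and e: "\<And>x. x < n \<Longrightarrow> e x = a ! x"
    and h: "\<And>u. 1 \<le> u \<Longrightarrow> u \<le> n \<Longrightarrow> h u = \<rho> u"
      "\<And>j. 1 \<le> j \<Longrightarrow> j \<le> n \<Longrightarrow> h (n + j) = length (label_class \<rho> n j)"
      "\<And>j. 1 \<le> j \<Longrightarrow> j \<le> c \<Longrightarrow> h (5 * n + j) = hd (label_class \<rho> n j)"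
      "\<And>j. 1 \<le> j \<Longrightarrow> j \<le> c \<Longrightarrow> h (6 * n + j) = row_start \<rho> n j"
    by (auto simp: s_eq sums_state_def workspace_def Let_def n_def)
  show ?thesis
    unfolding s_eq p n_def[symmetric]
    apply (rule reaches_step, simp, simp add: exec_unfold,
       simp add: exec_unfold r bnd, use n in \<open>simp add: bnd r\<close>)+
    apply (rule reaches_stop)
    using n by (auto simp: copy_state_def workspace_def r bnd Let_def h e n_def[symmetric])
qed

text \<open>Entry cells from \<open>n\<close> on are written and cells below \<open>n\<close> are read, so the input survives; rows
  of different classes do not meet because \<open>label_class \<rho> v j\<close> is a prefix of \<open>label_class \<rho> n j\<close>.\<close>

lemma copy_step:
  assumes v: "v < length a" and c: "c \<le> length a" and range: "\<And>u. u \<in> {1..length a} \<Longrightarrow> \<rho> u \<in> {1..c}"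
    and s: "copy_state a \<rho> c v s"
  shows "reaches toeplitz_program (100 * length a) 12 s (copy_state a \<rho> c (Suc v))"
proof -
  define n where "n = length a"
  define l where "l = \<rho> (Suc v)"
  define F where "F = hd (label_class \<rho> n l)"
  define T where "T = row_start \<rho> n l + length (label_class \<rho> v l)"
  have n: "Suc v \<le> n" and c: "c \<le> n" using v c by (auto simp: n_def)
  have l: "1 \<le> l" "l \<le> c" "l \<le> n" using range[of "Suc v"] n c by (auto simp: n_def l_def)
  obtain p r h e where s_eq: "s = \<lparr>pc = p, reg = r, mem = h, entry = e\<rparr>" by (cases s) auto
  from s have p: "p = 58" and bnd: "bounded_by (100 * n) r" "bounded_by (100 * n) h"
    and r: "r 0 = c" "r 1 = n" "r (Suc 0) = n" "r 2 = Suc v" "r 6 = 1" "r 7 = 0"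
      "r 8 = 2 * n" "r 9 = 4 * n" "r 10 = 5 * n" "r 11 = 6 * n"
    and e: "\<And>x. x < n \<Longrightarrow> e x = a ! x"
    and h: "\<And>u. 1 \<le> u \<Longrightarrow> u \<le> n \<Longrightarrow> h u = \<rho> u"
      "\<And>j. 1 \<le> j \<Longrightarrow> j \<le> n \<Longrightarrow> h (n + j) = length (label_class \<rho> n j)"
      "\<And>j. 1 \<le> j \<Longrightarrow> j \<le> c \<Longrightarrow> h (5 * n + j) = hd (label_class \<rho> n j)"
      "\<And>j. 1 \<le> j \<Longrightarrow> j \<le> c \<Longrightarrow> h (6 * n + j) = row_start \<rho> n j + length (label_class \<rho> v j)"
    and copied: "\<And>j t. 1 \<le> j \<Longrightarrow> j \<le> c \<Longrightarrow> t < length (label_class \<rho> v j) \<Longrightarrow>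
      e (row_start \<rho> n j + t) = a ! (label_class \<rho> v j ! t - hd (label_class \<rho> n j))"
    by (auto simp: s_eq copy_state_def workspace_def Let_def n_def)
  have reads: "h (Suc v) = l" "h (5 * n + l) = F" "h (6 * n + l) = T"
    using h(1)[of "Suc v"] h(3)[of l] h(4)[of l] n l by (auto simp: l_def F_def T_def)
  have prefix: "label_class \<rho> n j = label_class \<rho> v' j @ filter (\<lambda>u. \<rho> u = j) [Suc v'..<Suc n]"
    if "v' \<le> n" for j v'
  proof -
    have "[1..<Suc n] = [1..<Suc v'] @ [Suc v'..<Suc n]"
      using that upt_add_eq_append[of 1 "Suc v'" "n - v'"] by simp
    thus ?thesis unfolding label_class_def by (simp only: filter_append)
  qed
  have len: "length (label_class \<rho> v' j) \<le> length (label_class \<rho> n j)" if "v' \<le> n" for v' j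
    by (subst prefix[OF that, of j]) simp
  have fits: "row_start \<rho> n j + t < row_start \<rho> n (Suc j)"
    if "1 \<le> j" "v' \<le> n" "t < length (label_class \<rho> v' j)" for j t v'
    using len[OF that(2), of j] that by (simp add: row_start_Suc)
  have "T < row_start \<rho> n (Suc l)"
    unfolding T_def by (rule fits[of l "Suc v"]) (use n l in \<open>auto simp: label_class_Suc l_def\<close>)
  hence T: "n \<le> T" "T < 2 * n"
    using row_start_le[of \<rho> n "Suc l"] by (auto simp: T_def row_start_def)
  have F: "1 \<le> F \<and> F \<le> Suc v"
  proof -
    have nonempty: "label_class \<rho> (Suc v) l \<noteq> []" by (simp add: label_class_Suc l_def)
    have "F = hd (label_class \<rho> (Suc v) l)"
      unfolding F_def prefix[OF n, of l] by (rule hd_append2[OF nonempty])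
    also have "\<dots> \<in> set (label_class \<rho> (Suc v) l)" by (rule hd_in_set[OF nonempty])
    finally show ?thesis by (simp add: set_label_class)
  qed
  from this have source: "e (Suc v - F) = a ! (Suc v - F)" "Suc v - F \<le> n" using n by (auto intro!: e)
  define e' where "e' = e(T := a ! (Suc v - F))"
  have e'_input: "e' x = a ! x" if "x < n" for x using that T e by (simp add: e'_def)
  have e'_rows: "e' (row_start \<rho> n j + t) = a ! (label_class \<rho> (Suc v) j ! t - hd (label_class \<rho> n j))"
    if j: "1 \<le> j" "j \<le> c" and t: "t < length (label_class \<rho> (Suc v) j)" for j t
  proof (cases "j = l")
    case True
    show ?thesis
    proof (cases "t < length (label_class \<rho> v l)")
      case t: True
      thus ?thesis using copied[OF j, of t] True
        by (simp add: e'_def T_def label_class_Suc nth_append)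
    next
      case False
      hence "t = length (label_class \<rho> v l)" using t True by (simp add: label_class_Suc l_def)
      thus ?thesis using True by (simp add: e'_def T_def label_class_Suc l_def F_def)
    qed
  next
    case False
    hence same: "label_class \<rho> (Suc v) j = label_class \<rho> v j" by (simp add: label_class_Suc l_def)
    have "row_start \<rho> n j + t \<noteq> T"
    proof (cases "j < l")
      case True
      have "row_start \<rho> n j + t < row_start \<rho> n (Suc j)" by (rule fits[OF j(1) n t])
      also have "\<dots> \<le> row_start \<rho> n l" by (rule row_start_mono) (use True in simp)
      finally show ?thesis by (simp add: T_def)
    next
      case lj: False
      have "row_start \<rho> n (Suc l) \<le> row_start \<rho> n j" by (rule row_start_mono) (use lj False in simp)
      thus ?thesis using \<open>T < row_start \<rho> n (Suc l)\<close> by simp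
    qed
    thus ?thesis using copied[OF j, of t] t by (simp add: e'_def same)
  qed
  have final: "copy_state a \<rho> c (Suc v) \<lparr>pc = 58, reg = r', mem = h(6 * n + l := Suc T), entry = e'\<rparr>"
    if "bounded_by (100 * n) r'" "r' 0 = c" "r' 1 = n" "r' 2 = Suc (Suc v)" "r' 6 = 1" "r' 7 = 0"
      "r' 8 = 2 * n" "r' 9 = 4 * n" "r' 10 = 5 * n" "r' 11 = 6 * n" for r'
    using that h T l c bnd e'_input e'_rows unfolding copy_state_def workspace_def Let_def n_def[symmetric]
    by (auto simp: label_class_Suc l_def[symmetric] T_def[symmetric])
  show ?thesis
    unfolding s_eq p n_def[symmetric]
    apply (rule reaches_step, simp, simp add: exec_unfold,
       use n in \<open>simp add: exec_unfold r bnd reads source\<close>, use n l c T F source(2) in \<open>simp add: bnd r\<close>)+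
    apply (rule reaches_stop)
    using n l c T F source(2) by (intro final[unfolded e'_def]) (simp_all add: r bnd)
qed

section \<open>The linear time algorithm\<close>

theorem mainTheorem1:
  shows "\<exists>(P :: program) (C :: nat). \<forall>(n :: nat) (a :: real list). 1 \<le> n \<and> length a = n \<longrightarrow>
    (\<exists>s. computes_within P (C * n) (C * n) (initial_config n a) s \<and>
         output_count s = card (components (toeplitz_graph a)) \<and>
         component_index_sequence (toeplitz_graph a) (output_count s) (output_index s) \<and>
         frobenius_normal_form (toeplitz_mat a) (map toeplitz_mat (output_rows n s)))"
proof (intro exI[of _ toeplitz_program] exI[of _ 100] allI impI)
  fix n :: nat and a :: "real list"
  assume "1 \<le> n \<and> length a = n"
  hence n: "1 \<le> n" "length a = n" "a \<noteq> []" by auto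
  let ?S = "toeplitz_support a" and ?B = "100 * n"
  obtain b m g where sc: "scan ?S (n - 1) = (b, m, g)" by (metis prod_cases3)
  define d where "d = offset n g"
  define \<rho> where "\<rho> = label d"
  define c where "c = roots d n"
  have d_pos: "0 < d u" for u unfolding d_def by (rule offset_pos) (use n in simp)
  have c_le: "c \<le> n"
    unfolding c_def roots_def by (rule order_trans[OF card_mono[of "{1..n}"]]) auto
  have range: "\<rho> u \<in> {1..c}" if "u \<in> {1..n}" for u
    using label_bounds[of d u, OF d_pos] roots_mono[of u n d] that by (auto simp: \<rho>_def c_def)
  have surj: "\<exists>u \<in> {1..n}. \<rho> u = i" if "i \<in> {1..c}" for i
    using exists_label[of d i n, OF d_pos] that by (auto simp: \<rho>_def c_def)
  have conn: "\<rho> u = \<rho> v \<longleftrightarrow> (u, v) \<in> (edges (toeplitz_graph a))\<^sup>*" if "u \<in> {1..n}" "v \<in> {1..n}" for u v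
    using label_eq_iff[of d u n v, OF d_pos] scan_parent_edges[OF _ sc] that n
    by (simp add: rtrancl_toeplitz_edges \<rho>_def d_def)

  \<comment> \<open>the two summands are the way to the head of a loop, out of the preceding one, and the iterations\<close>
  have scanned: "reaches toeplitz_program ?B (8 + (n - 1) * 14) (initial_config n a) (scan_state a (n - 1))"
    by (rule reaches_trans[OF scan_start[OF n(3), unfolded n(2)]], rule reaches_loop)
      (use scan_step[of _ a] n in auto)
  have labelled: "reaches toeplitz_program ?B (4 + n * 20) s (label_state a g n)"
    if "scan_state a (n - 1) s" for s
    by (rule reaches_trans[OF label_start[OF n(3), unfolded n(2), OF sc that]], rule reaches_loop)
      (use label_step[of _ a g] n in auto)
  have summed: "reaches toeplitz_program ?B (3 + c * 8) s (sums_state a \<rho> c c)"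
    if "label_state a g n s" for s
    by (rule reaches_trans[OF sums_start[OF n(3), unfolded n(2), OF that, folded d_def, folded \<rho>_def c_def]],
        rule reaches_loop) (use sums_step[of _ c a \<rho>] n c_le in auto)
  have copied: "reaches toeplitz_program ?B (2 + n * 12) s (copy_state a \<rho> c n)"
    if "sums_state a \<rho> c c s" for s
    by (rule reaches_trans[OF copy_start[OF n(3), unfolded n(2), OF c_le that]], rule reaches_loop)
      (use copy_step[of _ a c \<rho>] n c_le range in auto)
  \<comment> \<open>one more comparison leaves the last loop and changes nothing but the program counter\<close>
  have halt: "reaches toeplitz_program ?B 1 s (\<lambda>s. copy_state a \<rho> c n (s\<lparr>pc := 58\<rparr>) \<and> pc s = 70)"
    if "copy_state a \<rho> c n s" for s
  proof -
    obtain p r h e where s_eq: "s = \<lparr>pc = p, reg = r, mem = h, entry = e\<rparr>" by (cases s) auto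
    from that have p: "p = 58" and r: "bounded_by ?B r" "bounded_by ?B h" "r 1 = n" "r (Suc 0) = n" "r 2 = Suc n"
      by (auto simp: copy_state_def workspace_def Let_def s_eq n)
    show ?thesis unfolding s_eq p
      apply (rule reaches_step, simp, simp add: exec_unfold, simp add: exec_unfold r, simp add: r)
      apply (rule reaches_stop)
      using that by (simp add: s_eq p)
  qed
  let ?final = "\<lambda>s. copy_state a \<rho> c n (s\<lparr>pc := 58\<rparr>) \<and> pc s = 70"
  have "reaches toeplitz_program ?B
      (8 + (n - 1) * 14 + (4 + n * 20 + (3 + c * 8 + (2 + n * 12 + 1)))) (initial_config n a) ?final"
    by (intro reaches_trans[OF scanned] reaches_trans[OF labelled] reaches_trans[OF summed]
        reaches_trans[OF copied] halt)
  hence "reaches toeplitz_program ?B ?B (initial_config n a) ?final"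
    by (rule reaches_mono) (use c_le n in auto)
  moreover have "words_at_most ?B (initial_config n a)"
    by (simp add: initial_config_def bounded_by_def)
  moreover have "halted toeplitz_program s" if "?final s" for s
    using that by (simp add: halted_def toeplitz_program_def)
  ultimately obtain s where comp: "computes_within toeplitz_program ?B ?B (initial_config n a) s"
    and fin: "copy_state a \<rho> c n (s\<lparr>pc := 58\<rparr>)"
    using reaches_computes[of toeplitz_program ?B ?B "initial_config n a" ?final] by blast
  from fin have count: "output_count s = c"
    and index: "\<And>u. u \<in> {1..n} \<Longrightarrow> output_index s u = \<rho> u"
    and size: "\<And>j. 1 \<le> j \<Longrightarrow> j \<le> n \<Longrightarrow> mem s (n + j) = length (label_class \<rho> n j)"
    and rows: "\<And>j t. 1 \<le> j \<Longrightarrow> j \<le> c \<Longrightarrow> t < length (label_class \<rho> n j) \<Longrightarrow>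
      entry s (row_start \<rho> n j + t) = a ! (label_class \<rho> n j ! t - hd (label_class \<rho> n j))"
    by (auto simp: copy_state_def Let_def n output_count_def output_index_def)
  have "output_row n s i = map (\<lambda>u. a ! (u - hd (label_class \<rho> n i))) (label_class \<rho> n i)"
    if i: "1 \<le> i" "i \<le> c" for i
  proof -
    have "(\<Sum>j = 1..<i. mem s (n + j)) = (\<Sum>j = 1..<i. length (label_class \<rho> n j))"
      by (rule sum.cong) (use size i c_le in auto)
    hence "output_row n s i = map (entry s) [row_start \<rho> n i..<row_start \<rho> n i + length (label_class \<rho> n i)]"
      using size[of i] i c_le by (simp add: output_row_def row_start_def Let_def)
    also have "\<dots> = map (\<lambda>u. a ! (u - hd (label_class \<rho> n i))) (label_class \<rho> n i)"
      by (rule nth_equalityI) (use rows[OF i] in auto)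
    finally show ?thesis .
  qed
  hence out: "map toeplitz_mat (output_rows n s) =
      map (\<lambda>i. toeplitz_mat (map (\<lambda>u. a ! (u - hd (label_class \<rho> n i))) (label_class \<rho> n i))) [1..<Suc c]"
    by (auto simp: output_rows_def count)
  note correct = labelling_correct[of a \<rho> c, unfolded n(2), OF range surj conn]
  have "component_index_sequence (toeplitz_graph a) c (output_index s)"
    using correct(2) index by (simp add: component_index_sequence_def n)
  moreover have "frobenius_normal_form (toeplitz_mat a) (map toeplitz_mat (output_rows n s))"
    unfolding out by (rule correct(3))
  ultimately show "\<exists>s. computes_within toeplitz_program (100 * n) (100 * n) (initial_config n a) s \<and>
         output_count s = card (components (toeplitz_graph a)) \<and>
         component_index_sequence (toeplitz_graph a) (output_count s) (output_index s) \<and>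
         frobenius_normal_form (toeplitz_mat a) (map toeplitz_mat (output_rows n s))"
    using comp count correct(1) by (intro exI[of _ s]) simp
qed

end
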